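(* Let $\mathbb D$ be a minimal Enriques diagram with exactly one root $R$, of weight $m_R$. Then: (a) $m_R\ge2$. (b) If $m_R=2$, then $\mathbb D$ is the diagram $A_k$ for some $k\ge1$. (c) If $m_R=3$, then $\mathbb D$ is one of the diagrams $D_k$ for some $k\ge4$, $E_{6l+j}$ for some $l\ge1$ and $j\in\{0,1,2\}$, or $J_{l,k}$ for some $l\ge2$ and $k\ge0$. (d) If $m_R\ge4$ and $\operatorname{cod}(\mathbb D)\le10$, then $m_R=4$ and $\mathbb D$ is one of $X_{1,0},X_{1,1},X_{1,2},Y_{1,1},Z_{11}$. In particular, the minimal Enriques diagrams with one root and with $\operatorname{cod}(\mathbb D)\le 10$ are precisely $$A_1,\dots,A_{10},\ D_4,\dots,D_{10},\ J_{2,0},\ J_{2,1},\ E_6,\ E_7,\ E_8,\ X_{1,0},\ X_{1,1},\ X_{1,2},\ Z_{11},\ Y_{1,1}.$$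
   Context: A forest is a disjoint union of trees, where a tree is a directed graph without loops having a single initial vertex (its root), and in which every other vertex has a unique immediate predecessor. A final vertex is a leaf. A vertex counts as one of its own predecessors and successors; its other predecessors and successors are called proper. A remote predecessor is a proper predecessor other than the immediate one. A minimal Enriques diagram $\mathbb D$ is a finite forest, each vertex $V$ having an integer weight $m_V\ge1$, with a binary relation $\succ$ on vertices ("proximity"), subject to the laws below. A vertex proximate to a remote predecessor is called a satellite; any other vertex is free. - Law of Proximity: a root is proximate to no vertex. A non-root vertex is proximate to its immediate predecessor and to at most one other vertex, which must be a remote predecessor. If one vertex is proximate to a second and a third lies properly between the two, then the third is also proximate to the second. - Proximity Inequality: $m_V\ge\sum_{W\succ V}m_W$ for each vertex $V$. - Law of Succession: a vertex $V$ may have at most $m_V$ immediate successors, of which any number may be free, but at most two may be satellites, and these must be satellites of different vertices. - Law of Minimality: every leaf of weight $1$ is a satellite. Set $\operatorname{cod}(\mathbb D)=\sum_{V}\binom{m_V+1}{2}-(\text{number of roots})-(\text{number of free vertices})$. Named diagrams (in each, a "succession" is a chain in which each vertex is the immediate successor of the previous one; non-root vertices are proximate to their immediate predecessors, and to no other vertices except as specified; "followed by" a diagram means that the root of that diagram becomes an immediate successor of the preceding vertex, with no further proximities): - $A_{2i-1}$ ($i\ge1$): a succession of $i$ free vertices of weight $2$. - $A_{2i}$ ($i\ge1$): a succession of $i$ free vertices of weight $2$, followed by two successive vertices of weight $1$ both proximate to the $i$th vertex. - $D_k$ ($k\ge4$): a root of weight $3$, followed by nothing if $k=4$; followed by two successive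 vertices of weight $1$ both proximate to the root if $k=5$; followed by the diagram $A_{k-5}$ if $k\ge6$. - $E_{6l+j}$ ($l\ge1$, $j=0,1,2$): a succession of $l$ vertices of weight $3$, followed by: if $j=0$, three successive vertices of weight $1$ all proximate to the $l$th vertex; if $j=1$, two successive vertices, the first of weight $2$ and the second of weight $1$, both proximate to the $l$th vertex; if $j=2$, three successive vertices, of weights $2,1,1$, the first two both proximate to the $l$th vertex and the last two both proximate to the $(l+1)$th vertex (the one of weight $2$). - $J_{l,k}$ ($l\ge2$, $k\ge0$): a succession of $l-1$ vertices of weight $3$ followed by the diagram $D_{k+4}$. - $X_{1,k}$ ($k=0,1,2$): a root of weight $4$, followed by nothing if $k=0$; by two successive vertices of weight $1$ both proximate to the root if $k=1$; by one vertex of weight $2$ if $k=2$. - $Y_{1,1}$: a root of weight $4$ with two immediate successors, each of weight $1$ and each having one immediate successor of weight $1$ that is proximate to the root. - $Z_{11}$: a root of weight $4$ followed by three successive vertices of weight $1$ all proximate to the root. *)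

theory Defs
  imports Complex_Main "Graph_Theory.Pair_Digraph"
begin

section \<open>Forests\<close>

text \<open>An arc \<open>(u, v)\<close> makes \<open>u\<close> an immediate predecessor of \<open>v\<close>; a proper predecessor is then
  an element below \<open>v\<close> in the transitive closure of the arc relation.\<close>

definition initial_vertices :: "'a pair_pre_digraph \<Rightarrow> 'a set" where
  "initial_vertices G = {v \<in> pverts G. \<nexists>u. (u, v) \<in> parcs G}"

text \<open>``Without loops'' means without directed cycles of any length: excluding only arcs from a
  vertex to itself would admit a root together with a disjoint directed cycle.\<close>

definition rooted_tree :: "'a pair_pre_digraph \<Rightarrow> bool" where
  "rooted_tree G \<longleftrightarrow>
     pair_wf_digraph G \<and> acyclic (parcs G) \<and>
     (\<exists>r. initial_vertices G = {r}) \<and>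
     (\<forall>v \<in> pverts G - initial_vertices G. \<exists>!u. (u, v) \<in> parcs G)"

definition rooted_forest :: "'a pair_pre_digraph \<Rightarrow> bool" where
  "rooted_forest G \<longleftrightarrow>
     (\<exists>\<T>. (\<forall>T \<in> \<T>. rooted_tree T) \<and>
          pairwise (\<lambda>S T. disjnt (pverts S) (pverts T)) \<T> \<and>
          pverts G = (\<Union>T \<in> \<T>. pverts T) \<and>
          parcs G = (\<Union>T \<in> \<T>. parcs T))"

definition proper_predecessor :: "'a pair_pre_digraph \<Rightarrow> 'a \<Rightarrow> 'a \<Rightarrow> bool" where
  "proper_predecessor G U V \<longleftrightarrow> (U, V) \<in> (parcs G)\<^sup>+"

definition remote_predecessor :: "'a pair_pre_digraph \<Rightarrow> 'a \<Rightarrow> 'a \<Rightarrow> bool" where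
  "remote_predecessor G U V \<longleftrightarrow> proper_predecessor G U V \<and> (U, V) \<notin> parcs G"


section \<open>Minimal Enriques diagrams\<close>

text \<open>\<open>(W, V) \<in> prox D\<close> says that \<open>W\<close> is proximate to \<open>V\<close>.\<close>

record 'a weighted_diagram =
  graph :: "'a pair_pre_digraph"
  weight :: "'a \<Rightarrow> nat"
  prox :: "'a rel"

abbreviation vertices :: "'a weighted_diagram \<Rightarrow> 'a set" where
  "vertices D \<equiv> pverts (graph D)"

abbreviation roots :: "'a weighted_diagram \<Rightarrow> 'a set" where
  "roots D \<equiv> initial_vertices (graph D)"

definition immediate_successors :: "'a weighted_diagram \<Rightarrow> 'a \<Rightarrow> 'a set" where
  "immediate_successors D V = {W. (V, W) \<in> parcs (graph D)}"

definition leaves :: "'a weighted_diagram \<Rightarrow> 'a set" where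
  "leaves D = {V \<in> vertices D. immediate_successors D V = {}}"

definition satellite_of :: "'a weighted_diagram \<Rightarrow> 'a \<Rightarrow> 'a \<Rightarrow> bool" where
  "satellite_of D W V \<longleftrightarrow> (W, V) \<in> prox D \<and> remote_predecessor (graph D) V W"

definition satellites :: "'a weighted_diagram \<Rightarrow> 'a set" where
  "satellites D = {W \<in> vertices D. \<exists>V. satellite_of D W V}"

definition free_vertices :: "'a weighted_diagram \<Rightarrow> 'a set" where
  "free_vertices D = vertices D - satellites D"

definition law_of_proximity :: "'a weighted_diagram \<Rightarrow> bool" where
  "law_of_proximity D \<longleftrightarrow>
     (\<forall>V \<in> roots D. \<forall>U. (V, U) \<notin> prox D) \<and>
     (\<forall>V \<in> vertices D. \<forall>P. (P, V) \<in> parcs (graph D) \<longrightarrow>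
        (V, P) \<in> prox D \<and>
        (\<exists>\<^sub>\<le>\<^sub>1 U. (V, U) \<in> prox D \<and> U \<noteq> P) \<and>
        (\<forall>U. (V, U) \<in> prox D \<and> U \<noteq> P \<longrightarrow> remote_predecessor (graph D) U V)) \<and>
     (\<forall>V U W. (V, U) \<in> prox D \<and>
        proper_predecessor (graph D) U W \<and> proper_predecessor (graph D) W V \<longrightarrow>
        (W, U) \<in> prox D)"

definition proximity_inequality :: "'a weighted_diagram \<Rightarrow> bool" where
  "proximity_inequality D \<longleftrightarrow>
     (\<forall>V \<in> vertices D. weight D V \<ge> (\<Sum>W | (W, V) \<in> prox D. weight D W))"

definition law_of_succession :: "'a weighted_diagram \<Rightarrow> bool" where
  "law_of_succession D \<longleftrightarrow>
     (\<forall>V \<in> vertices D.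
        card (immediate_successors D V) \<le> weight D V \<and>
        card (immediate_successors D V \<inter> satellites D) \<le> 2 \<and>
        (\<forall>W \<in> immediate_successors D V. \<forall>W' \<in> immediate_successors D V.
           \<forall>U U'. W \<noteq> W' \<and> satellite_of D W U \<and> satellite_of D W' U' \<longrightarrow> U \<noteq> U'))"

definition law_of_minimality :: "'a weighted_diagram \<Rightarrow> bool" where
  "law_of_minimality D \<longleftrightarrow> (\<forall>V \<in> leaves D. weight D V = 1 \<longrightarrow> V \<in> satellites D)"

definition minimal_enriques_diagram :: "'a weighted_diagram \<Rightarrow> bool" where
  "minimal_enriques_diagram D \<longleftrightarrow>
     rooted_forest (graph D) \<and> finite (vertices D) \<and>
     (\<forall>V \<in> vertices D. weight D V \<ge> 1) \<and>
     prox D \<subseteq> vertices D \<times> vertices D \<and>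
     law_of_proximity D \<and> proximity_inequality D \<and>
     law_of_succession D \<and> law_of_minimality D"

definition cod :: "'a weighted_diagram \<Rightarrow> int" where
  "cod D = (\<Sum>V \<in> vertices D. int ((weight D V + 1) choose 2))
             - int (card (roots D)) - int (card (free_vertices D))"

text \<open>Equality of diagrams up to renaming the vertices. Weights are compared on vertices only,
  whereas arcs and proximities of \<open>E\<close> are exactly the images of those of \<open>D\<close>.\<close>

definition diagram_iso :: "'a weighted_diagram \<Rightarrow> 'b weighted_diagram \<Rightarrow> bool" where
  "diagram_iso D E \<longleftrightarrow>
     (\<exists>f. inj_on f (vertices D) \<and>
          vertices E = f ` vertices D \<and>
          parcs (graph E) = map_prod f f ` parcs (graph D) \<and>
          prox E = map_prod f f ` prox D \<and>
          (\<forall>V \<in> vertices D. weight E (f V) = weight D V))"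


section \<open>The named diagrams\<close>

text \<open>A succession is given by the list of its vertices. \<open>Plain m\<close> has weight \<open>m\<close> and is proximate
  only to its immediate predecessor (if any); \<open>Back m d\<close> is proximate in addition to the vertex
  \<open>d\<close> steps before it. As the distances are relative, ``followed by'' is concatenation of lists.\<close>

datatype chain_vertex = Plain (cv_weight: nat) | Back (cv_weight: nat) nat

definition succession :: "chain_vertex list \<Rightarrow> nat weighted_diagram" where
  "succession xs =
     \<lparr>graph = \<lparr>pverts = {..<length xs}, parcs = {(i, Suc i) | i. Suc i < length xs}\<rparr>,
      weight = (\<lambda>i. cv_weight (xs ! i)),
      prox = {(Suc i, i) | i. Suc i < length xs} \<union>
             {(i + d, i) | i d m. i + d < length xs \<and> xs ! (i + d) = Back m d}\<rparr>"

text \<open>For \<open>k = 2 i - 1\<close> and for \<open>k = 2 i\<close> alike, \<open>i = (k + 1) div 2\<close>.\<close>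

definition A_chain :: "nat \<Rightarrow> chain_vertex list" where
  "A_chain k = replicate ((k + 1) div 2) (Plain 2) @ (if even k then [Plain 1, Back 1 2] else [])"

definition D_chain :: "nat \<Rightarrow> chain_vertex list" where
  "D_chain k = Plain 3 #
     (if k = 4 then [] else if k = 5 then [Plain 1, Back 1 2] else A_chain (k - 5))"

definition E_chain :: "nat \<Rightarrow> nat \<Rightarrow> chain_vertex list" where
  "E_chain l j = replicate l (Plain 3) @
     (if j = 0 then [Plain 1, Back 1 2, Back 1 3]
      else if j = 1 then [Plain 2, Back 1 2]
      else [Plain 2, Back 1 2, Back 1 2])"

definition J_chain :: "nat \<Rightarrow> nat \<Rightarrow> chain_vertex list" where
  "J_chain l k = replicate (l - 1) (Plain 3) @ D_chain (k + 4)"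

definition diagram_A :: "nat \<Rightarrow> nat weighted_diagram" where
  "diagram_A k = succession (A_chain k)"

definition diagram_D :: "nat \<Rightarrow> nat weighted_diagram" where
  "diagram_D k = succession (D_chain k)"

text \<open>\<open>diagram_E l j\<close> is the diagram written $E_{6l+j}$.\<close>

definition diagram_E :: "nat \<Rightarrow> nat \<Rightarrow> nat weighted_diagram" where
  "diagram_E l j = succession (E_chain l j)"

definition diagram_J :: "nat \<Rightarrow> nat \<Rightarrow> nat weighted_diagram" where
  "diagram_J l k = succession (J_chain l k)"

definition diagram_X1 :: "nat \<Rightarrow> nat weighted_diagram" where
  "diagram_X1 k = succession (Plain 4 #
     (if k = 0 then [] else if k = 1 then [Plain 1, Back 1 2] else [Plain 2]))"

definition diagram_Y11 :: "nat weighted_diagram" where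
  "diagram_Y11 =
     \<lparr>graph = \<lparr>pverts = {0, 1, 2, 3, 4}, parcs = {(0, 1), (0, 2), (1, 3), (2, 4)}\<rparr>,
      weight = (\<lambda>i. if i = 0 then 4 else 1),
      prox = {(1, 0), (2, 0), (3, 1), (4, 2), (3, 0), (4, 0)}\<rparr>"

definition diagram_Z11 :: "nat weighted_diagram" where
  "diagram_Z11 = succession [Plain 4, Plain 1, Back 1 2, Back 1 3]"

end

(* A vertex V of weight 1 has at most one vertex proximate to it. If V is free, it is not a leaf, and
   by induction from the leaves its unique successor cannot be free: a free vertex of weight 1 is
   followed by a satellite of weight 1 proximate to the predecessor of V. Hence every branch of
   weight 1 uses up at least 2 in the proximity inequality at the vertex where it starts, and every
   further successor after a vertex of weight 1 is again a satellite. For root weight 2 or 3 this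
   leaves a single branch at each vertex, found by walking upwards from the root until a leaf is
   reached. For larger weights, cod D + 1 is a sum of nonnegative costs of the vertices: a root of
   weight 4 costs 9 and one of greater weight at least 14, so that the other vertices together cost
   at most 2, where a satellite costs at least 1 and a vertex of weight 2 at least 2. *)

theory Submission
  imports Defs
begin

section \<open>Renaming vertices\<close>

text \<open>The third clause of the Law of Proximity is what makes walking up the tree possible: if
  \<open>W\<close> is an immediate successor of \<open>V\<close>, then a second target of
  \<open>W\<close> is one that \<open>V\<close> already has. So proximity is inherited step by step,
  and dies as soon as the Proximity Inequality of a target is exhausted. Exhaustion is shown by
  adding the weights of known vertices, which must be distinct; depth in the tree serves to tell
  them apart. Every diagram found is a chain except Y_{1,1}, so a diagram is compared with a list of
  chain vertices, and what precedes the start of a walk is left variable, so that a walk can be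
  extended back towards the root. The converse of the classification concerns every renaming of a
  listed diagram; hence the transport of all laws along renamings and a criterion for chains that
  can be evaluated. The infinite families are cut off by closed formulas: \<open>cod\<close> is k
  for A_k and D_k, 5l + j + 1 for E_{6l+j} and 5l + k - 1 for J_{l,k}.\<close>

lemma in_trancl_image_iff:
  assumes "inj_on f A" "r \<subseteq> A \<times> A" "u \<in> A" "v \<in> A"
  shows "(f u, f v) \<in> (map_prod f f ` r)\<^sup>+ \<longleftrightarrow> (u, v) \<in> r\<^sup>+"
proof
  have "\<exists>u v. u \<in> A \<and> v \<in> A \<and> x = f u \<and> y = f v \<and> (u, v) \<in> r\<^sup>+"
    if "(x, y) \<in> (map_prod f f ` r)\<^sup>+" for x y
    using that
  proof (induction rule: trancl_induct)
    case (base y)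
    then show ?case using assms(2) by auto
  next
    case (step y z)
    then obtain u v where uv: "u \<in> A" "v \<in> A" "x = f u" "y = f v" "(u, v) \<in> r\<^sup>+" by blast
    from step(2) obtain v' w where vw: "(v', w) \<in> r" "y = f v'" "z = f w" by auto
    \<comment> \<open>Injectivity makes the end of the lifted path and the start of the lifted arc
      the same vertex, so the two can be joined.\<close>
    then have "v' = v" using uv assms(1,2) by (metis inj_onD mem_Sigma_iff subsetD)
    then have "(u, w) \<in> r\<^sup>+" using uv vw by auto
    then show ?case using uv vw assms(2) by blast
  qed
  then show "(u, v) \<in> r\<^sup>+" if "(f u, f v) \<in> (map_prod f f ` r)\<^sup>+"
    using that assms(1,3,4) by (metis inj_onD)
next
  assume "(u, v) \<in> r\<^sup>+"
  then show "(f u, f v) \<in> (map_prod f f ` r)\<^sup>+"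
  proof (induction rule: trancl_induct)
    case (base y)
    then show ?case by (metis map_prod_imageI r_into_trancl)
  next
    case (step y z)
    then show ?case by (metis map_prod_imageI trancl.trancl_into_trancl)
  qed
qed

text \<open>\<open>N\<close> is the model and \<open>D\<close> its renamed copy. The map
  \<open>f\<close> is controlled only on \<open>vertices N\<close>, and the record type does not
  confine arcs and proximities to the vertices; the last two assumptions do.\<close>

locale diagram_renaming =
  fixes N :: "'b weighted_diagram" and D :: "'a weighted_diagram" and f :: "'b \<Rightarrow> 'a"
  assumes inj: "inj_on f (vertices N)"
    and vertices_eq: "vertices D = f ` vertices N"
    and arcs_eq: "parcs (graph D) = map_prod f f ` parcs (graph N)"
    and prox_eq: "prox D = map_prod f f ` prox N"
    and weight_eq: "V \<in> vertices N \<Longrightarrow> weight D (f V) = weight N V"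
    and arcs_subset: "parcs (graph N) \<subseteq> vertices N \<times> vertices N"
    and prox_subset: "prox N \<subseteq> vertices N \<times> vertices N"
begin

lemma arc_iff:
  assumes "u \<in> vertices N" "v \<in> vertices N"
  shows "(f u, f v) \<in> parcs (graph D) \<longleftrightarrow> (u, v) \<in> parcs (graph N)"
proof
  assume "(f u, f v) \<in> parcs (graph D)"
  then obtain u' v' where "(u', v') \<in> parcs (graph N)" "f u = f u'" "f v = f v'"
    unfolding arcs_eq by auto
  then show "(u, v) \<in> parcs (graph N)"
    using assms arcs_subset inj by (metis inj_onD mem_Sigma_iff subsetD)
qed (simp add: arcs_eq map_prod_imageI)

lemma prox_iff:
  assumes "u \<in> vertices N" "v \<in> vertices N"
  shows "(f u, f v) \<in> prox D \<longleftrightarrow> (u, v) \<in> prox N"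
proof
  assume "(f u, f v) \<in> prox D"
  then obtain u' v' where "(u', v') \<in> prox N" "f u = f u'" "f v = f v'"
    unfolding prox_eq by auto
  then show "(u, v) \<in> prox N"
    using assms prox_subset inj by (metis inj_onD mem_Sigma_iff subsetD)
qed (simp add: prox_eq map_prod_imageI)

lemma arcE:
  assumes "(x, y) \<in> parcs (graph D)"
  obtains u v where "u \<in> vertices N" "v \<in> vertices N" "x = f u" "y = f v"
    "(u, v) \<in> parcs (graph N)"
  using assms arcs_subset unfolding arcs_eq by fastforce

lemma proxE:
  assumes "(x, y) \<in> prox D"
  obtains u v where "u \<in> vertices N" "v \<in> vertices N" "x = f u" "y = f v" "(u, v) \<in> prox N"
  using assms prox_subset unfolding prox_eq by fastforce

lemma proper_predecessor_iff:
  "u \<in> vertices N \<Longrightarrow> v \<in> vertices N \<Longrightarrow>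
    proper_predecessor (graph D) (f u) (f v) \<longleftrightarrow> proper_predecessor (graph N) u v"
  unfolding proper_predecessor_def arcs_eq using in_trancl_image_iff[OF inj arcs_subset] by simp

lemma remote_predecessor_iff:
  "u \<in> vertices N \<Longrightarrow> v \<in> vertices N \<Longrightarrow>
    remote_predecessor (graph D) (f u) (f v) \<longleftrightarrow> remote_predecessor (graph N) u v"
  unfolding remote_predecessor_def by (simp add: arc_iff proper_predecessor_iff)

lemma satellite_of_iff:
  "u \<in> vertices N \<Longrightarrow> v \<in> vertices N \<Longrightarrow> satellite_of D (f u) (f v) \<longleftrightarrow> satellite_of N u v"
  unfolding satellite_of_def by (simp add: prox_iff remote_predecessor_iff)

lemma satellites_subset: "satellites N \<subseteq> vertices N"
  by (auto simp: satellites_def)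

lemma satellite_iff:
  assumes "u \<in> vertices N"
  shows "f u \<in> satellites D \<longleftrightarrow> u \<in> satellites N"
proof -
  have "(\<exists>y. satellite_of D (f u) y) \<longleftrightarrow> (\<exists>v\<in>vertices N. satellite_of D (f u) (f v))"
    unfolding satellite_of_def by (metis proxE)
  also have "\<dots> \<longleftrightarrow> (\<exists>v. satellite_of N u v)"
    using assms satellite_of_iff prox_subset unfolding satellite_of_def by blast
  finally show ?thesis using assms by (auto simp: satellites_def vertices_eq)
qed

lemma satellites_eq: "satellites D = f ` satellites N"
proof -
  have "satellites D \<subseteq> f ` vertices N" by (auto simp: satellites_def vertices_eq)
  then show ?thesis using satellite_iff satellites_subset by blast
qed

lemma initial_iff:
  assumes "u \<in> vertices N"
  shows "f u \<in> roots D \<longleftrightarrow> u \<in> roots N"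
proof -
  have "(\<exists>y. (y, f u) \<in> parcs (graph D)) \<longleftrightarrow> (\<exists>v\<in>vertices N. (f v, f u) \<in> parcs (graph D))"
    by (metis arcE)
  also have "\<dots> \<longleftrightarrow> (\<exists>v. (v, u) \<in> parcs (graph N))"
    using assms arc_iff arcs_subset by blast
  finally show ?thesis using assms by (auto simp: initial_vertices_def vertices_eq)
qed

lemma roots_subset: "roots N \<subseteq> vertices N"
  by (auto simp: initial_vertices_def)

lemma roots_eq: "roots D = f ` roots N"
proof -
  have "roots D \<subseteq> f ` vertices N" by (auto simp: initial_vertices_def vertices_eq)
  then show ?thesis using initial_iff roots_subset by blast
qed

lemma immediate_successors_subset: "immediate_successors N V \<subseteq> vertices N"
  using arcs_subset by (auto simp: immediate_successors_def)

lemma immediate_successors_eq: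
  assumes "V \<in> vertices N"
  shows "immediate_successors D (f V) = f ` immediate_successors N V"
proof (intro equalityI subsetI)
  fix y assume "y \<in> immediate_successors D (f V)"
  then have y: "(f V, y) \<in> parcs (graph D)" by (simp add: immediate_successors_def)
  then obtain w where "w \<in> vertices N" "y = f w" by (metis arcE)
  then show "y \<in> f ` immediate_successors N V"
    using y assms arc_iff by (auto simp: immediate_successors_def)
qed (use assms immediate_successors_subset arc_iff in \<open>force simp: immediate_successors_def\<close>)

lemma proximate_eq:
  assumes "V \<in> vertices N"
  shows "{W. (W, f V) \<in> prox D} = f ` {W. (W, V) \<in> prox N}"
proof (intro equalityI subsetI)
  fix y assume "y \<in> {W. (W, f V) \<in> prox D}"
  then have y: "(y, f V) \<in> prox D" by simp
  then obtain w where "w \<in> vertices N" "y = f w" by (metis proxE)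
  then show "y \<in> f ` {W. (W, V) \<in> prox N}"
    using y assms prox_iff by auto
qed (use assms prox_subset prox_iff in \<open>auto\<close>)

lemma rooted_tree:
  assumes "rooted_tree (graph N)"
  shows "rooted_tree (graph D)"
  unfolding rooted_tree_def
proof (intro conjI ballI)
  show "pair_wf_digraph (graph D)"
    by unfold_locales (use arcs_subset in \<open>auto simp: arcs_eq vertices_eq\<close>)
  show "acyclic (parcs (graph D))"
  proof (rule acyclicI, intro allI notI)
    fix x assume x: "(x, x) \<in> (parcs (graph D))\<^sup>+"
    then obtain y where "(x, y) \<in> parcs (graph D)" by (meson tranclD)
    then obtain u where "u \<in> vertices N" "x = f u" by (metis arcE)
    then have "(u, u) \<in> (parcs (graph N))\<^sup>+"
      using x in_trancl_image_iff[OF inj arcs_subset] unfolding arcs_eq by blast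
    then show False using assms by (auto simp: rooted_tree_def acyclic_def)
  qed
  obtain r where "roots N = {r}" using assms by (auto simp: rooted_tree_def)
  then show "\<exists>r. roots D = {r}" by (simp add: roots_eq)
  fix y assume y: "y \<in> vertices D - roots D"
  then obtain v where v: "v \<in> vertices N" "y = f v" by (auto simp: vertices_eq)
  then have "v \<notin> roots N" using y by (simp add: initial_iff)
  then obtain u where u: "(u, v) \<in> parcs (graph N)"
    and uniq: "\<And>u'. (u', v) \<in> parcs (graph N) \<Longrightarrow> u' = u"
    using assms v unfolding rooted_tree_def by blast
  show "\<exists>!x. (x, y) \<in> parcs (graph D)"
  proof
    show "(f u, y) \<in> parcs (graph D)" using u v by (auto simp: arcs_eq)
    fix x assume "(x, y) \<in> parcs (graph D)"
    then show "x = f u" using v uniq arc_iff by (metis arcE)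
  qed
qed

section \<open>Transport of the laws along a renaming\<close>

lemma law_of_proximity:
  assumes "law_of_proximity N"
  shows "law_of_proximity D"
  unfolding law_of_proximity_def
proof (intro conjI ballI allI impI)
  fix x y assume x: "x \<in> roots D"
  show "(x, y) \<notin> prox D"
  proof
    assume "(x, y) \<in> prox D"
    then obtain v u where v: "v \<in> vertices N" "x = f v" "(v, u) \<in> prox N" by (metis proxE)
    then have "v \<in> roots N" using x initial_iff by simp
    then show False using v assms by (simp add: law_of_proximity_def)
  qed
next
  fix x p assume "x \<in> vertices D" "(p, x) \<in> parcs (graph D)"
  then obtain v q where v: "v \<in> vertices N" "q \<in> vertices N" "x = f v" "p = f q"
    "(q, v) \<in> parcs (graph N)"
    by (metis arcE)
  then have N: "(v, q) \<in> prox N" "\<exists>\<^sub>\<le>\<^sub>1 u. (v, u) \<in> prox N \<and> u \<noteq> q"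
    "\<And>u. (v, u) \<in> prox N \<Longrightarrow> u \<noteq> q \<Longrightarrow> remote_predecessor (graph N) u v"
    using assms by (simp_all add: law_of_proximity_def)
  show "(x, p) \<in> prox D" using v N(1) by (simp add: prox_iff)
  show "\<exists>\<^sub>\<le>\<^sub>1 y. (x, y) \<in> prox D \<and> y \<noteq> p"
    unfolding Uniq_def
  proof (intro allI impI)
    fix y z assume "(x, y) \<in> prox D \<and> y \<noteq> p" "(x, z) \<in> prox D \<and> z \<noteq> p"
    then obtain u w where "u \<in> vertices N" "y = f u" "u \<noteq> q" "w \<in> vertices N" "z = f w" "w \<noteq> q"
      "(v, u) \<in> prox N" "(v, w) \<in> prox N"
      using v prox_iff by (elim conjE proxE) metis
    then show "y = z" using N(2) unfolding Uniq_def by blast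
  qed
  fix y assume y: "(x, y) \<in> prox D \<and> y \<noteq> p"
  then obtain u where "u \<in> vertices N" "y = f u" by (metis proxE)
  then show "remote_predecessor (graph D) y x"
    using y v N(3) by (simp add: remote_predecessor_iff prox_iff) blast
next
  fix x y z
  assume A: "(x, y) \<in> prox D \<and> proper_predecessor (graph D) y z \<and> proper_predecessor (graph D) z x"
  then have "(y, z) \<in> (parcs (graph D))\<^sup>+" by (simp add: proper_predecessor_def)
  \<comment> \<open>The middle vertex is known only through paths; as the end of an arc it has a
    preimage in \<open>N\<close>.\<close>
  then obtain z' where "(z', z) \<in> parcs (graph D)" by (meson tranclD2)
  then obtain w where w: "w \<in> vertices N" "z = f w" by (metis arcE)
  obtain v u where vu: "v \<in> vertices N" "u \<in> vertices N" "x = f v" "y = f u"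
    using A by (metis proxE)
  have "(v, u) \<in> prox N \<and> proper_predecessor (graph N) u w \<and> proper_predecessor (graph N) w v"
    using A w vu by (simp add: prox_iff proper_predecessor_iff)
  then have "(w, u) \<in> prox N"
    using assms unfolding law_of_proximity_def by blast
  then show "(z, y) \<in> prox D" using w vu prox_iff by simp
qed

lemma proximity_inequality:
  assumes "proximity_inequality N"
  shows "proximity_inequality D"
  unfolding proximity_inequality_def
proof
  fix x assume "x \<in> vertices D"
  then obtain V where V: "V \<in> vertices N" "x = f V" by (auto simp: vertices_eq)
  have sub: "{W. (W, V) \<in> prox N} \<subseteq> vertices N" using prox_subset by auto
  have "(\<Sum>W | (W, f V) \<in> prox D. weight D W) = (\<Sum>W | (W, V) \<in> prox N. weight D (f W))"
    using V by (simp add: proximate_eq sum.reindex[OF inj_on_subset[OF inj sub]])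
  also have "\<dots> = (\<Sum>W | (W, V) \<in> prox N. weight N W)"
    using sub by (intro sum.cong) (auto simp: weight_eq)
  finally show "(\<Sum>W | (W, x) \<in> prox D. weight D W) \<le> weight D x"
    using V assms by (simp add: weight_eq proximity_inequality_def)
qed

lemma law_of_succession:
  assumes "law_of_succession N"
  shows "law_of_succession D"
  unfolding law_of_succession_def
proof (intro ballI conjI allI impI)
  fix x assume "x \<in> vertices D"
  then obtain V where V: "V \<in> vertices N" "x = f V" by (auto simp: vertices_eq)
  note sub = immediate_successors_subset[of V]
  show "card (immediate_successors D x) \<le> weight D x"
    using V assms
    by (simp add: immediate_successors_eq weight_eq card_image[OF inj_on_subset[OF inj sub]]
        law_of_succession_def)
  have "immediate_successors D x \<inter> satellites D = f ` (immediate_successors N V \<inter> satellites N)"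
    using V by (simp add: immediate_successors_eq satellites_eq
        inj_on_image_Int[OF inj sub satellites_subset])
  then show "card (immediate_successors D x \<inter> satellites D) \<le> 2"
    using V assms sub
    by (simp add: law_of_succession_def card_image inj_on_subset[OF inj] le_infI1)
  fix y z U U'
  assume yz: "y \<in> immediate_successors D x" "z \<in> immediate_successors D x"
    "y \<noteq> z \<and> satellite_of D y U \<and> satellite_of D z U'"
  then obtain v w where vw: "v \<in> immediate_successors N V" "w \<in> immediate_successors N V"
    "y = f v" "z = f w"
    using V by (auto simp: immediate_successors_eq)
  obtain u u' where "u \<in> vertices N" "u' \<in> vertices N" "U = f u" "U' = f u'"
    using yz unfolding satellite_of_def by (metis proxE)
  then show "U \<noteq> U'"
    using vw yz V sub assms satellite_of_iff inj unfolding law_of_succession_def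
    by (metis inj_onD subsetD)
qed

lemma law_of_minimality:
  assumes "law_of_minimality N"
  shows "law_of_minimality D"
  unfolding law_of_minimality_def
proof (intro ballI impI)
  fix x assume x: "x \<in> leaves D" "weight D x = 1"
  then obtain V where V: "V \<in> vertices N" "x = f V" by (auto simp: vertices_eq leaves_def)
  then show "x \<in> satellites D"
    using x assms
    by (auto simp: law_of_minimality_def leaves_def immediate_successors_eq satellites_eq weight_eq)
qed

text \<open>Assuming \<open>rooted_tree\<close> besides minimality avoids transporting a
  decomposition into trees: the forest is the one tree \<open>graph D\<close>.\<close>

lemma minimal_enriques_diagram:
  assumes "minimal_enriques_diagram N" "rooted_tree (graph N)"
  shows "minimal_enriques_diagram D"
proof -
  have "rooted_forest (graph D)"
    unfolding rooted_forest_def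
    by (rule exI[of _ "{graph D}"]) (use assms(2) rooted_tree in \<open>auto simp: pairwise_def\<close>)
  moreover have "prox D \<subseteq> vertices D \<times> vertices D"
    using prox_subset by (auto simp: prox_eq vertices_eq)
  ultimately show ?thesis
    using assms law_of_proximity proximity_inequality law_of_succession law_of_minimality
    by (auto simp: minimal_enriques_diagram_def vertices_eq weight_eq)
qed

lemma cod_eq: "cod D = cod N"
proof -
  have "free_vertices D = f ` free_vertices N"
    using inj_on_image_set_diff[OF inj, of "vertices N" "satellites N"] satellites_subset
    by (simp add: free_vertices_def vertices_eq satellites_eq)
  moreover have "free_vertices N \<subseteq> vertices N" by (auto simp: free_vertices_def)
  ultimately show ?thesis
    unfolding cod_def using roots_subset
    by (simp add: roots_eq vertices_eq sum.reindex[OF inj] weight_eq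
        card_image inj_on_subset[OF inj])
qed

end

lemma diagram_isoE:
  assumes "diagram_iso N D"
    and "parcs (graph N) \<subseteq> vertices N \<times> vertices N" "prox N \<subseteq> vertices N \<times> vertices N"
  obtains f where "diagram_renaming N D f"
proof -
  obtain f where "inj_on f (vertices N)" "vertices D = f ` vertices N"
    "parcs (graph D) = map_prod f f ` parcs (graph N)" "prox D = map_prod f f ` prox N"
    "\<forall>V\<in>vertices N. weight D (f V) = weight N V"
    using assms(1) unfolding diagram_iso_def by (elim exE conjE)
  then have "diagram_renaming N D f" using assms(2,3) by unfold_locales simp_all
  then show thesis by (rule that)
qed

section \<open>Successions\<close>

text \<open>The default 0 is never a distance \<open>i - j\<close> with \<open>j < i\<close>, so a
  \<open>Plain\<close> vertex gets no second target in \<open>proximate_at\<close>, and the interval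
  of intermediate vertices in \<open>lawful\<close> is empty.\<close>

primrec back_steps :: "chain_vertex \<Rightarrow> nat" where
  "back_steps (Plain m) = 0"
| "back_steps (Back m d) = d"

text \<open>Indices range over \<open>set [0..<length xs]\<close> to keep these conditions executable.\<close>

definition well_placed :: "chain_vertex list \<Rightarrow> bool" where
  "well_placed xs \<longleftrightarrow>
     (\<forall>i\<in>set [0..<length xs]. is_Plain (xs ! i) \<or> 2 \<le> back_steps (xs ! i) \<and> back_steps (xs ! i) \<le> i)"

definition proximate_at :: "chain_vertex list \<Rightarrow> nat \<Rightarrow> nat \<Rightarrow> bool" where
  "proximate_at xs i j \<longleftrightarrow> j < i \<and> (i = Suc j \<or> back_steps (xs ! i) = i - j)"

text \<open>An executable form of the laws for a chain: the clause on intermediate vertices need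
  only be tested at the target of a back step, and the Law of Minimality only at the last vertex,
  the one leaf. The Law of Succession is automatic for a chain of positive weights.\<close>

definition lawful :: "chain_vertex list \<Rightarrow> bool" where
  "lawful xs \<longleftrightarrow> xs \<noteq> [] \<and> well_placed xs \<and>
     (\<forall>i\<in>set [0..<length xs].
        cv_weight (xs ! i) \<ge> 1 \<and>
        (\<forall>k\<in>set [Suc (i - back_steps (xs ! i))..<i]. proximate_at xs k (i - back_steps (xs ! i))) \<and>
        (\<Sum>j\<leftarrow>filter (\<lambda>j. proximate_at xs j i) [0..<length xs]. cv_weight (xs ! j))
          \<le> cv_weight (xs ! i)) \<and>
     (cv_weight (last xs) = 1 \<longrightarrow> \<not> is_Plain (last xs))"

lemma vertices_succession [simp]: "vertices (succession xs) = {..<length xs}"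
  by (simp add: succession_def)

lemma weight_succession [simp]: "weight (succession xs) i = cv_weight (xs ! i)"
  by (simp add: succession_def)

lemma arcs_succession: "parcs (graph (succession xs)) = {(i, Suc i) | i. Suc i < length xs}"
  by (simp add: succession_def)

lemma arcs_succession_subset:
  "parcs (graph (succession xs)) \<subseteq> vertices (succession xs) \<times> vertices (succession xs)"
  by (auto simp: arcs_succession)

lemma prox_succession_subset:
  "prox (succession xs) \<subseteq> vertices (succession xs) \<times> vertices (succession xs)"
  by (auto simp: succession_def)


lemma proper_predecessor_succession:
  "proper_predecessor (graph (succession xs)) i j \<longleftrightarrow> i < j \<and> j < length xs"
proof
  assume "proper_predecessor (graph (succession xs)) i j"
  then have "(i, j) \<in> (parcs (graph (succession xs)))\<^sup>+" by (simp add: proper_predecessor_def)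
  then show "i < j \<and> j < length xs"
    by (induction rule: trancl_induct) (auto simp: arcs_succession)
next
  have "(i, i + Suc k) \<in> (parcs (graph (succession xs)))\<^sup>+" if "i + Suc k < length xs" for k
    using that
  proof (induction k)
    case 0
    then show ?case by (auto simp: arcs_succession)
  next
    case (Suc k)
    then have "(i + Suc k, i + Suc (Suc k)) \<in> parcs (graph (succession xs))"
      by (simp add: arcs_succession)
    then show ?case using Suc by (simp add: trancl_into_trancl)
  qed
  moreover assume "i < j \<and> j < length xs"
  ultimately show "proper_predecessor (graph (succession xs)) i j"
    unfolding proper_predecessor_def by (metis add_Suc_right less_imp_Suc_add)
qed

lemma remote_predecessor_succession:
  "remote_predecessor (graph (succession xs)) i j \<longleftrightarrow> Suc i < j \<and> j < length xs"
  by (auto simp: remote_predecessor_def proper_predecessor_succession arcs_succession)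

text \<open>The hypothesis excludes \<open>Back m 0\<close>, which in \<open>succession\<close>
  would make a vertex proximate to itself.\<close>

lemma prox_succession:
  assumes "well_placed xs"
  shows "(i, j) \<in> prox (succession xs) \<longleftrightarrow> i < length xs \<and> proximate_at xs i j"
proof
  assume "(i, j) \<in> prox (succession xs)"
  then consider "i = Suc j" "i < length xs"
    | m d where "i = j + d" "i < length xs" "xs ! i = Back m d"
    by (auto simp: succession_def)
  then show "i < length xs \<and> proximate_at xs i j"
  proof cases
    case 2
    then have "2 \<le> d" using assms by (auto simp: well_placed_def dest!: bspec[of _ _ i])
    then show ?thesis using 2 by (auto simp: proximate_at_def)
  qed (auto simp: proximate_at_def)
next
  assume i: "i < length xs \<and> proximate_at xs i j"
  show "(i, j) \<in> prox (succession xs)"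
  proof (cases "i = Suc j")
    case False
    then have "i = j + (i - j)" "xs ! i = Back (cv_weight (xs ! i)) (i - j)"
      using i by (cases "xs ! i"; auto simp: proximate_at_def)+
    then show ?thesis using i unfolding succession_def by simp metis
  qed (use i in \<open>auto simp: succession_def\<close>)
qed

text \<open>A back step of length at least 2 makes its target remote, and a length of at most
  \<open>i\<close> makes the target exist; so the \<open>Back\<close> vertices are exactly the
  satellites.\<close>

lemma satellite_of_succession:
  assumes "well_placed xs"
  shows "satellite_of (succession xs) i j \<longleftrightarrow>
    i < length xs \<and> \<not> is_Plain (xs ! i) \<and> j + back_steps (xs ! i) = i"
proof (cases "i < length xs")
  case True
  then have "is_Plain (xs ! i) \<or> 2 \<le> back_steps (xs ! i) \<and> back_steps (xs ! i) \<le> i"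
    using assms by (simp add: well_placed_def)
  then show ?thesis
    using True assms
    by (cases "xs ! i") (auto simp: satellite_of_def prox_succession remote_predecessor_succession
        proximate_at_def)
qed (simp add: satellite_of_def remote_predecessor_succession)

lemma satellites_succession:
  assumes "well_placed xs"
  shows "satellites (succession xs) = {i. i < length xs \<and> \<not> is_Plain (xs ! i)}"
proof -
  have "i - back_steps (xs ! i) + back_steps (xs ! i) = i"
    if "i < length xs" "\<not> is_Plain (xs ! i)" for i
    using that assms by (auto simp: well_placed_def)
  then show ?thesis
    by (auto simp: satellites_def satellite_of_succession[OF assms])
qed

lemma roots_succession: "roots (succession xs) = (if xs = [] then {} else {0})"
proof -
  have "(\<exists>u. (u, v) \<in> parcs (graph (succession xs))) \<longleftrightarrow> 0 < v" if "v < length xs" for v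
    using that by (cases v) (auto simp: arcs_succession)
  then show ?thesis by (auto simp: initial_vertices_def)
qed

lemma rooted_tree_succession:
  assumes "xs \<noteq> []"
  shows "rooted_tree (graph (succession xs))"
  unfolding rooted_tree_def
proof (intro conjI ballI)
  show "pair_wf_digraph (graph (succession xs))"
    by unfold_locales (auto simp: arcs_succession)
  show "acyclic (parcs (graph (succession xs)))"
    using proper_predecessor_succession[of xs] by (auto simp: acyclic_def proper_predecessor_def)
  show "\<exists>r. roots (succession xs) = {r}" using assms by (simp add: roots_succession)
  fix v assume "v \<in> vertices (succession xs) - roots (succession xs)"
  then obtain u where "v = Suc u" "v < length xs"
    using assms by (cases v) (auto simp: roots_succession)
  then show "\<exists>!u. (u, v) \<in> parcs (graph (succession xs))" by (auto simp: arcs_succession)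
qed

lemma immediate_successors_succession:
  "immediate_successors (succession xs) i = (if Suc i < length xs then {Suc i} else {})"
  by (auto simp: immediate_successors_def arcs_succession)

lemma minimal_enriques_diagram_succession:
  assumes "lawful xs"
  shows "minimal_enriques_diagram (succession xs)"
proof -
  note [simp] = proper_predecessor_succession remote_predecessor_succession
    immediate_successors_succession
  have xs: "xs \<noteq> []" "well_placed xs" using assms by (auto simp: lawful_def)
  have wt: "cv_weight (xs ! i) \<ge> 1"
    and between: "\<And>k. i - back_steps (xs ! i) < k \<Longrightarrow> k < i \<Longrightarrow>
      proximate_at xs k (i - back_steps (xs ! i))"
    and ineq: "(\<Sum>j\<leftarrow>filter (\<lambda>j. proximate_at xs j i) [0..<length xs]. cv_weight (xs ! j))
          \<le> cv_weight (xs ! i)" if "i < length xs" for i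
    using assms that by (simp_all add: lawful_def)
  note prox = prox_succession[OF xs(2)]
  have "law_of_proximity (succession xs)"
    unfolding law_of_proximity_def
  proof (intro conjI ballI allI impI)
    fix i j assume "i \<in> roots (succession xs)"
    then show "(i, j) \<notin> prox (succession xs)"
      using xs by (simp add: roots_succession prox proximate_at_def)
  next
    fix i p assume "i \<in> vertices (succession xs)" "(p, i) \<in> parcs (graph (succession xs))"
    then have i: "i = Suc p" "i < length xs" by (auto simp: arcs_succession)
    show "(i, p) \<in> prox (succession xs)" using i by (simp add: prox proximate_at_def)
    show "\<exists>\<^sub>\<le>\<^sub>1 j. (i, j) \<in> prox (succession xs) \<and> j \<noteq> p"
      using i by (auto simp: Uniq_def prox proximate_at_def)
    fix j assume "(i, j) \<in> prox (succession xs) \<and> j \<noteq> p"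
    then show "remote_predecessor (graph (succession xs)) j i"
      using i by (auto simp: prox proximate_at_def)
  next
    fix i j k
    assume "(i, j) \<in> prox (succession xs) \<and> proper_predecessor (graph (succession xs)) j k \<and>
      proper_predecessor (graph (succession xs)) k i"
    \<comment> \<open>As \<open>k\<close> lies strictly between, \<open>j\<close> is not the
      immediate predecessor of \<open>i\<close> and must be the target of its back step.\<close>
    then have "i < length xs" "j = i - back_steps (xs ! i)" "j < k" "k < i"
      by (auto simp: prox proximate_at_def)
    then show "(k, j) \<in> prox (succession xs)" using between by (simp add: prox)
  qed
  moreover have "proximity_inequality (succession xs)"
    unfolding proximity_inequality_def
  proof
    fix i assume "i \<in> vertices (succession xs)"
    then have i: "i < length xs" by simp
    have "{j. (j, i) \<in> prox (succession xs)} =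
        set (filter (\<lambda>j. proximate_at xs j i) [0..<length xs])"
      by (auto simp: prox)
    then show "(\<Sum>W | (W, i) \<in> prox (succession xs). weight (succession xs) W)
        \<le> weight (succession xs) i"
      using ineq[OF i] by (simp only: sum.distinct_set_conv_list distinct_filter distinct_upt
          weight_succession)
  qed
  \<comment> \<open>There is at most one immediate successor, which a positive weight
    permits.\<close>
  moreover have "law_of_succession (succession xs)"
    unfolding law_of_succession_def
    using wt by (auto simp: Int_insert_left)
  moreover have "law_of_minimality (succession xs)"
    unfolding law_of_minimality_def
  proof (intro ballI impI)
    fix i assume i: "i \<in> leaves (succession xs)" "weight (succession xs) i = 1"
    then have "i = length xs - 1" "i < length xs" by (auto simp: leaves_def split: if_splits)
    then show "i \<in> satellites (succession xs)"
      using assms i xs by (auto simp: satellites_succession lawful_def last_conv_nth)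
  qed
  moreover have "rooted_forest (graph (succession xs))"
    unfolding rooted_forest_def
    by (rule exI[of _ "{graph (succession xs)}"])
      (use rooted_tree_succession[OF xs(1)] in \<open>auto simp: pairwise_def\<close>)
  ultimately show ?thesis
    using wt prox_succession_subset by (simp add: minimal_enriques_diagram_def)
qed

text \<open>The share of one vertex in \<open>cod\<close>, where free means \<open>Plain\<close>.
  The root term is left out and reappears as the \<open>- 1\<close> of
  \<open>cod_succession\<close>.\<close>

definition vertex_cod :: "chain_vertex \<Rightarrow> int" where
  "vertex_cod x = int ((cv_weight x + 1) choose 2) - (if is_Plain x then 1 else 0)"

lemma cod_succession:
  assumes "xs \<noteq> []" "well_placed xs"
  shows "cod (succession xs) = (\<Sum>x\<leftarrow>xs. vertex_cod x) - 1"
proof -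
  have free: "free_vertices (succession xs) = {i\<in>{..<length xs}. is_Plain (xs ! i)}"
    using assms by (auto simp: free_vertices_def satellites_succession)
  have "(\<Sum>x\<leftarrow>xs. vertex_cod x) = (\<Sum>i<length xs. vertex_cod (xs ! i))"
    by (simp add: sum_list_sum_nth atLeast0LessThan)
  also have "\<dots> = (\<Sum>i<length xs. int ((cv_weight (xs ! i) + 1) choose 2))
      - (\<Sum>i<length xs. if is_Plain (xs ! i) then 1 else 0)"
    by (simp add: vertex_cod_def sum_subtractf)
  also have "(\<Sum>i<length xs. if is_Plain (xs ! i) then 1 else 0 :: int)
      = int (card (free_vertices (succession xs)))"
    unfolding free by (subst sum.inter_filter[symmetric]) auto
  finally show ?thesis using assms by (simp add: cod_def roots_succession)
qed

text \<open>The chains of the final list, that is, all its diagrams but Y_{1,1}; the last four are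
  X_{1,0}, X_{1,1}, X_{1,2} and Z_{11}. The bound 11 stands for codimension 10, because the root
  term is still to be subtracted.\<close>

lemma lawful_small_chains:
  "\<forall>xs\<in>set (map A_chain [1..<11] @ map D_chain [4..<11] @
     [J_chain 2 0, J_chain 2 1, E_chain 1 0, E_chain 1 1, E_chain 1 2, [Plain 4],
      [Plain 4, Plain 1, Back 1 2], [Plain 4, Plain 2], [Plain 4, Plain 1, Back 1 2, Back 1 3]]).
     lawful xs \<and> (\<Sum>x\<leftarrow>xs. vertex_cod x) \<le> 11"
  by code_simp

section \<open>The named chains\<close>

lemma well_placed_iff:
  "well_placed xs \<longleftrightarrow>
     (\<forall>i<length xs. is_Plain (xs ! i) \<or> 2 \<le> back_steps (xs ! i) \<and> back_steps (xs ! i) \<le> i)"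
  by (auto simp: well_placed_def)

text \<open>Distances are relative and every old index grows by one, so no back step reaches past
  the front.\<close>

lemma well_placed_Cons:
  assumes "well_placed xs" shows "well_placed (Plain m # xs)"
  unfolding well_placed_iff
proof (intro allI impI)
  fix i assume "i < length (Plain m # xs)"
  then show "is_Plain ((Plain m # xs) ! i) \<or>
      2 \<le> back_steps ((Plain m # xs) ! i) \<and> back_steps ((Plain m # xs) ! i) \<le> i"
    using assms by (cases i) (auto simp: well_placed_iff)
qed

lemma A_chain_1: "A_chain 1 = [Plain 2]"
  and A_chain_2: "A_chain 2 = [Plain 2, Plain 1, Back 1 2]"
  and A_chain_step: "A_chain (Suc (Suc k)) = Plain 2 # A_chain k"
  by (simp_all add: A_chain_def)

lemma D_chain_4: "D_chain 4 = [Plain 3]"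
  and D_chain_5: "D_chain 5 = [Plain 3, Plain 1, Back 1 2]"
  and D_chain_step: "k \<ge> 1 \<Longrightarrow> D_chain (k + 5) = Plain 3 # A_chain k"
  by (simp_all add: D_chain_def)

lemma E_chain_step: "E_chain (Suc l) j = Plain 3 # E_chain l j"
  by (simp add: E_chain_def)

text \<open>J_{l,k} is named only for l at least 2; continuing the formula to l = 1 gives D_{k+4},
  the base of the recursion.\<close>

lemma J_chain_1: "J_chain 1 k = D_chain (k + 4)"
  and J_chain_step: "l \<ge> 1 \<Longrightarrow> J_chain (Suc l) k = Plain 3 # J_chain l k"
  by (simp add: J_chain_def, cases l, simp_all add: J_chain_def)

text \<open>Two steps in \<open>k\<close> add one free vertex of weight 2, which contributes 3 - 1 =
  2. In the next three lemmas a free vertex of weight 3 contributes 6 - 1 = 5 in the same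
  way.\<close>

lemma A_chain_properties:
  assumes "k \<ge> 1"
  shows "A_chain k \<noteq> [] \<and> well_placed (A_chain k) \<and> (\<Sum>x\<leftarrow>A_chain k. vertex_cod x) = int k + 1"
  using assms
proof (induction k rule: less_induct)
  case (less k)
  consider "k = 1" | "k = 2" | "k \<ge> 3" using less.prems by linarith
  then show ?case
  proof cases
    case 3
    then obtain k' where "k = Suc (Suc k')" "k' \<ge> 1" by (metis Suc_le_D Suc_le_mono numeral_3_eq_3 One_nat_def)
    then show ?thesis using less.IH[of k']
      by (simp add: A_chain_step well_placed_Cons vertex_cod_def eval_nat_numeral)
  qed (simp_all only: A_chain_1 A_chain_2,
      simp_all add: well_placed_def vertex_cod_def eval_nat_numeral)
qed

lemma D_chain_properties:
  assumes "k \<ge> 4"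
  shows "D_chain k \<noteq> [] \<and> well_placed (D_chain k) \<and> (\<Sum>x\<leftarrow>D_chain k. vertex_cod x) = int k + 1"
proof -
  consider "k = 4" | "k = 5" | "k \<ge> 6" using assms by linarith
  then show ?thesis
  proof cases
    case 3
    then have "D_chain k = Plain 3 # A_chain (k - 5)" using D_chain_step[of "k - 5"] by simp
    then show ?thesis using A_chain_properties[of "k - 5"] 3
      by (simp add: well_placed_Cons vertex_cod_def eval_nat_numeral)
  qed (simp_all only: D_chain_4 D_chain_5,
      simp_all add: well_placed_def vertex_cod_def eval_nat_numeral)
qed

lemma E_chain_properties:
  assumes "l \<ge> 1" "j \<in> {0, 1, 2}"
  shows "E_chain l j \<noteq> [] \<and> well_placed (E_chain l j) \<and>
    (\<Sum>x\<leftarrow>E_chain l j. vertex_cod x) = 5 * int l + int j + 2"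
  using assms(1)
proof (induction l rule: dec_induct)
  case base
  have "\<forall>j\<in>set [0, 1, 2]. E_chain 1 j \<noteq> [] \<and> well_placed (E_chain 1 j) \<and>
      (\<Sum>x\<leftarrow>E_chain 1 j. vertex_cod x) = 5 * int 1 + int j + 2"
    by code_simp
  then show ?case using assms(2) by auto
next
  case (step l)
  then show ?case by (simp add: E_chain_step well_placed_Cons vertex_cod_def eval_nat_numeral)
qed

lemma J_chain_properties:
  assumes "l \<ge> 1"
  shows "J_chain l k \<noteq> [] \<and> well_placed (J_chain l k) \<and>
    (\<Sum>x\<leftarrow>J_chain l k. vertex_cod x) = 5 * int l + int k"
  using assms
proof (induction l rule: dec_induct)
  case base
  show ?case using D_chain_properties[of "k + 4"] by (simp only: J_chain_1) simp
next
  case (step l)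
  then show ?case by (simp add: J_chain_step well_placed_Cons vertex_cod_def eval_nat_numeral)
qed

text \<open>The chains of claim (c), gathered in one set because an induction over vertices of
  weight 3 needs a class closed under prepending such a vertex.\<close>

definition triple_chains :: "chain_vertex list set" where
  "triple_chains = D_chain ` {4..} \<union> (\<Union>l\<in>{1..}. E_chain l ` {0, 1, 2}) \<union> (\<Union>l\<in>{2..}. range (J_chain l))"

lemma triple_chains_intros:
  "k \<ge> 4 \<Longrightarrow> D_chain k \<in> triple_chains"
  "l \<ge> 1 \<Longrightarrow> j \<in> {0, 1, 2} \<Longrightarrow> E_chain l j \<in> triple_chains"
  "l \<ge> 2 \<Longrightarrow> J_chain l k \<in> triple_chains"
  unfolding triple_chains_def by blast+

text \<open>Prepending turns D_k into J_{2,k-4}, and in the families E and J it raises l by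
  one.\<close>

lemma Plain_3_Cons_triple_chains:
  assumes "xs \<in> triple_chains"
  shows "Plain 3 # xs \<in> triple_chains"
proof -
  consider k where "k \<ge> 4" "xs = D_chain k"
    | l j where "l \<ge> 1" "j \<in> {0, 1, 2}" "xs = E_chain l j" | l k where "l \<ge> 2" "xs = J_chain l k"
    using assms unfolding triple_chains_def by blast
  then show ?thesis
  proof cases
    case (1 k)
    then have "Plain 3 # xs = J_chain 2 (k - 4)"
      using J_chain_1[of "k - 4"] J_chain_step[of 1 "k - 4"] by (simp add: numeral_2_eq_2)
    then show ?thesis using triple_chains_intros(3)[of 2] by simp
  next
    case (2 l j)
    then show ?thesis using triple_chains_intros(2)[of "Suc l" j] by (simp only: E_chain_step)
  next
    case (3 l k)
    then show ?thesis using triple_chains_intros(3)[of "Suc l" k] J_chain_step[of l k] by simp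
  qed
qed

section \<open>The diagram \<open>Y\<^sub>1\<^sub>,\<^sub>1\<close>\<close>

lemma Y11_simps [simp]:
  "vertices diagram_Y11 = {0, 1, 2, 3, 4}"
  "parcs (graph diagram_Y11) = {(0, 1), (0, 2), (1, 3), (2, 4)}"
  "weight diagram_Y11 = (\<lambda>i. if i = 0 then 4 else 1)"
  "prox diagram_Y11 = {(1, 0), (2, 0), (3, 1), (4, 2), (3, 0), (4, 0)}"
  by (simp_all add: diagram_Y11_def)

lemma proper_predecessor_Y11:
  "proper_predecessor (graph diagram_Y11) i j \<longleftrightarrow>
    (i, j) \<in> {(0, 1), (0, 2), (1, 3), (2, 4), (0, 3), (0, 4)}"
  unfolding proper_predecessor_def
proof
  assume "(i, j) \<in> (parcs (graph diagram_Y11))\<^sup>+"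
  then show "(i, j) \<in> {(0, 1), (0, 2), (1, 3), (2, 4), (0, 3), (0, 4)}"
    by (induction rule: trancl_induct) auto
next
  let ?A = "parcs (graph diagram_Y11)"
  have arcs: "(0, 1) \<in> ?A" "(0, 2) \<in> ?A" "(1, 3) \<in> ?A" "(2, 4) \<in> ?A" by simp_all
  then have "(0, 3) \<in> ?A\<^sup>+" "(0, 4) \<in> ?A\<^sup>+" by (meson trancl.intros)+
  moreover assume "(i, j) \<in> {(0, 1), (0, 2), (1, 3), (2, 4), (0, 3), (0, 4)}"
  ultimately show "(i, j) \<in> ?A\<^sup>+"
    using arcs by (elim insertE emptyE) (simp_all only: prod.inject r_into_trancl)
qed

lemma roots_Y11: "roots diagram_Y11 = {0}"
  by (auto simp: initial_vertices_def)

lemma rooted_tree_Y11: "rooted_tree (graph diagram_Y11)"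
  unfolding rooted_tree_def
proof (intro conjI)
  show "pair_wf_digraph (graph diagram_Y11)" by unfold_locales auto
  show "acyclic (parcs (graph diagram_Y11))"
  proof (rule acyclicI, intro allI notI)
    fix x assume "(x, x) \<in> (parcs (graph diagram_Y11))\<^sup>+"
    then have "proper_predecessor (graph diagram_Y11) x x" by (simp only: proper_predecessor_def)
    then show False by (auto simp: proper_predecessor_Y11)
  qed
  show "\<exists>r. roots diagram_Y11 = {r}" by (simp add: roots_Y11)
  show "\<forall>v\<in>vertices diagram_Y11 - roots diagram_Y11. \<exists>!u. (u, v) \<in> parcs (graph diagram_Y11)"
    by (auto simp: roots_Y11)
qed

lemma remote_predecessor_Y11:
  "remote_predecessor (graph diagram_Y11) i j \<longleftrightarrow> (i, j) = (0, 3) \<or> (i, j) = (0, 4)"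
  unfolding remote_predecessor_def proper_predecessor_Y11 by auto

lemma satellite_of_Y11: "satellite_of diagram_Y11 i j \<longleftrightarrow> (i = 3 \<or> i = 4) \<and> j = 0"
  unfolding satellite_of_def remote_predecessor_Y11 by auto

lemma satellites_Y11: "satellites diagram_Y11 = {3, 4}"
  unfolding satellites_def satellite_of_Y11 by auto

lemma minimal_enriques_diagram_Y11: "minimal_enriques_diagram diagram_Y11"
proof -
  have succs: "immediate_successors diagram_Y11 i =
      (if i = 0 then {1, 2} else if i = 1 then {3} else if i = 2 then {4} else {})" for i
    by (auto simp: immediate_successors_def)
  have prox: "{W. (W, i) \<in> prox diagram_Y11} =
      (if i = 0 then {1, 2, 3, 4} else if i = 1 then {3} else if i = 2 then {4} else {})" for i
    by auto
  have "law_of_proximity diagram_Y11"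
    unfolding law_of_proximity_def
    by (auto simp: roots_Y11 remote_predecessor_Y11 proper_predecessor_Y11 Uniq_def)
  moreover have "proximity_inequality diagram_Y11"
    unfolding proximity_inequality_def prox by simp
  moreover have "law_of_succession diagram_Y11"
    unfolding law_of_succession_def
    by (auto simp: succs satellites_Y11 satellite_of_Y11)
  moreover have "law_of_minimality diagram_Y11"
    by (auto simp: law_of_minimality_def leaves_def succs satellites_Y11)
  moreover have "rooted_forest (graph diagram_Y11)"
    unfolding rooted_forest_def
    by (rule exI[of _ "{graph diagram_Y11}"])
      (use rooted_tree_Y11 in \<open>auto simp: pairwise_def simp del: Y11_simps\<close>)
  ultimately show ?thesis by (auto simp: minimal_enriques_diagram_def)
qed

lemma cod_Y11: "cod diagram_Y11 = 10"
proof -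
  have "free_vertices diagram_Y11 = {0, 1, 2}"
    by (auto simp: free_vertices_def satellites_Y11)
  then show ?thesis by (simp add: cod_def roots_Y11 eval_nat_numeral)
qed

section \<open>Diagrams with one root\<close>

lemma choose_2_mono: "m \<le> n \<Longrightarrow> (m + 1) choose 2 \<le> (n + 1) choose 2"
  by (induction n rule: dec_induct) (simp_all add: numeral_2_eq_2)

locale one_root_diagram =
  fixes D :: "'a weighted_diagram" and R :: 'a
  assumes minimal: "minimal_enriques_diagram D"
    and roots_eq: "roots D = {R}"
begin

abbreviation "arcs_D \<equiv> parcs (graph D)"
abbreviation "succs \<equiv> immediate_successors D"

abbreviation prox_targets :: "'a \<Rightarrow> 'a set" where
  "prox_targets V \<equiv> prox D `` {V}"

abbreviation prox_sources :: "'a \<Rightarrow> 'a set" where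
  "prox_sources V \<equiv> {W. (W, V) \<in> prox D}"

lemma
  shows finite_vertices: "finite (vertices D)"
    and weight_pos: "V \<in> vertices D \<Longrightarrow> weight D V \<ge> 1"
    and prox_subset: "prox D \<subseteq> vertices D \<times> vertices D"
  using minimal by (auto simp: minimal_enriques_diagram_def)

section \<open>The tree underlying a diagram with one root\<close>

text \<open>The initial vertex of each tree of the forest is initial in the whole graph, because an
  arc into it from another tree would contradict disjointness. Hence it is \<open>R\<close>, and
  disjointness leaves only one tree.\<close>

lemma rooted_tree: "rooted_tree (graph D)"
proof -
  have "rooted_forest (graph D)" using minimal by (simp add: minimal_enriques_diagram_def)
  then obtain \<T> where \<T>: "\<forall>T\<in>\<T>. rooted_tree T"
      "pairwise (\<lambda>S T. disjnt (pverts S) (pverts T)) \<T>"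
      "vertices D = (\<Union>T \<in> \<T>. pverts T)" "arcs_D = (\<Union>T \<in> \<T>. parcs T)"
    unfolding rooted_forest_def by (elim exE conjE)
  have same: "S = T" if "v \<in> pverts S" "v \<in> pverts T" "S \<in> \<T>" "T \<in> \<T>" for S T v
    using \<T>(2) that by (metis disjnt_iff pairwiseD)
  have R_in: "R \<in> pverts T" if T: "T \<in> \<T>" for T
  proof -
    obtain r where "initial_vertices T = {r}" using \<T>(1) T by (auto simp: rooted_tree_def)
    then have r: "r \<in> pverts T" "\<And>u. (u, r) \<notin> parcs T" by (auto simp: initial_vertices_def)
    have "(u, r) \<notin> arcs_D" for u
    proof
      assume "(u, r) \<in> arcs_D"
      then obtain S where S: "S \<in> \<T>" "(u, r) \<in> parcs S" using \<T>(4) by auto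
      then interpret pair_wf_digraph S using \<T>(1) by (simp add: rooted_tree_def)
      have "r \<in> pverts S" using S(2) in_arcsD2 by blast
      then show False using same r S T by metis
    qed
    then have "r \<in> roots D" using r(1) T \<T>(3) by (auto simp: initial_vertices_def)
    then show ?thesis using r(1) roots_eq by simp
  qed
  have "R \<in> vertices D" using roots_eq by (auto simp: initial_vertices_def)
  then obtain T where T: "T \<in> \<T>" using \<T>(3) by auto
  then have "\<T> = {T}" using same R_in by blast
  then have "graph D = T" using \<T>(3,4) by (intro pair_pre_digraph.equality) auto
  then show ?thesis using \<T>(1) T by simp
qed

lemma arc_vertices: "(V, W) \<in> arcs_D \<Longrightarrow> V \<in> vertices D \<and> W \<in> vertices D"
proof -
  interpret pair_wf_digraph "graph D" using rooted_tree by (simp add: rooted_tree_def)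
  show "(V, W) \<in> arcs_D \<Longrightarrow> V \<in> vertices D \<and> W \<in> vertices D"
    using in_arcsD1 in_arcsD2 by blast
qed

lemma in_succs_iff: "W \<in> succs V \<longleftrightarrow> (V, W) \<in> arcs_D"
  by (simp add: immediate_successors_def)

lemma arcs_subset: "arcs_D \<subseteq> vertices D \<times> vertices D"
  using arc_vertices by auto

lemma succ_vertex: "W \<in> succs V \<Longrightarrow> W \<in> vertices D"
  using arc_vertices by (auto simp: in_succs_iff)

lemma root_vertex: "R \<in> vertices D" and root_no_pred: "(V, R) \<notin> arcs_D"
  using roots_eq by (auto simp: initial_vertices_def)

lemma finite_arcs: "finite arcs_D"
  by (rule finite_subset[OF arcs_subset]) (simp add: finite_vertices)

lemma acyclic_arcs: "acyclic arcs_D"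
  using rooted_tree by (simp add: rooted_tree_def)

lemma pred_unique:
  assumes "W \<in> succs V" "W \<in> succs V'"
  shows "V = V'"
proof -
  have "W \<in> vertices D - roots D"
    using assms arc_vertices root_no_pred by (auto simp: in_succs_iff roots_eq)
  then show ?thesis
    using assms rooted_tree unfolding rooted_tree_def by (metis in_succs_iff)
qed

text \<open>This is induction from the leaves: a claim about a vertex may be assumed for its
  immediate successors.\<close>

lemma wf_succs: "wf {(W, V). W \<in> succs V}"
  using finite_acyclic_wf_converse[OF finite_arcs acyclic_arcs]
  by (simp add: in_succs_iff converse_unfold)

text \<open>Induction from the root: a non-root vertex has an immediate predecessor, which already
  lies in \<open>A\<close>. So local knowledge of successor sets determines all the
  vertices.\<close>

lemma vertices_eqI:
  assumes "R \<in> A" "A \<subseteq> vertices D" "\<And>V. V \<in> A \<Longrightarrow> succs V \<subseteq> A"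
  shows "vertices D = A"
proof -
  have "V \<in> vertices D \<longrightarrow> V \<in> A" for V
  proof (induction V rule: wf_induct_rule[OF finite_acyclic_wf[OF finite_arcs acyclic_arcs]])
    case (1 V)
    show ?case
    proof (cases "V = R")
      case False
      show ?thesis
      proof
        assume V: "V \<in> vertices D"
        then have "V \<notin> roots D" using False roots_eq by simp
        then obtain U where "(U, V) \<in> arcs_D" using V by (auto simp: initial_vertices_def)
        then show "V \<in> A" using 1 assms(3) arc_vertices in_succs_iff by blast
      qed
    qed (use assms in simp)
  qed
  then show ?thesis using assms(2) by auto
qed

text \<open>Depth in the tree. It proves vertices distinct where their weights are added in the
  Proximity Inequality.\<close>

definition level :: "'a \<Rightarrow> nat" where
  "level V = card {U. (U, V) \<in> arcs_D\<^sup>+}"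

lemma trancl_arcs_subset: "arcs_D\<^sup>+ \<subseteq> vertices D \<times> vertices D"
  by (rule trancl_subset_Sigma[OF arcs_subset])

lemma trancl_succ:
  assumes "W \<in> succs V" "(U, W) \<in> arcs_D\<^sup>+"
  shows "U = V \<or> (U, V) \<in> arcs_D\<^sup>+"
  using assms(2)
proof (cases rule: tranclE)
  case (step V')
  then show ?thesis using assms(1) pred_unique in_succs_iff by metis
qed (use assms(1) pred_unique in_succs_iff in metis)

lemma level_succ:
  assumes "W \<in> succs V"
  shows "level W = Suc (level V)"
proof -
  have "{U. (U, W) \<in> arcs_D\<^sup>+} = insert V {U. (U, V) \<in> arcs_D\<^sup>+}"
    using assms trancl_succ[OF assms] by (auto simp: in_succs_iff intro: trancl_into_trancl)
  moreover have "(V, V) \<notin> arcs_D\<^sup>+" using acyclic_arcs by (auto simp: acyclic_def)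
  moreover have "finite {U. (U, V) \<in> arcs_D\<^sup>+}"
    by (rule finite_subset[OF _ finite_vertices]) (use trancl_arcs_subset in auto)
  ultimately show ?thesis by (simp add: level_def)
qed

section \<open>Inheritance of proximity\<close>

lemma prox_targets_root: "prox_targets R = {}"
  using minimal unfolding minimal_enriques_diagram_def law_of_proximity_def roots_eq by auto

lemma succ_prox:
  assumes "W \<in> succs V"
  shows "(W, V) \<in> prox D"
  using assms minimal arc_vertices
  unfolding minimal_enriques_diagram_def law_of_proximity_def in_succs_iff by blast

lemma prox_remote:
  assumes "W \<in> succs V" "(W, U) \<in> prox D" "U \<noteq> V"
  shows "remote_predecessor (graph D) U W"
  using assms minimal arc_vertices[of V W]
  unfolding minimal_enriques_diagram_def law_of_proximity_def in_succs_iff by blast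

text \<open>A second target \<open>U\<close> of \<open>W\<close> is a remote predecessor of
  \<open>W\<close>, hence a proper predecessor of \<open>V\<close>. So \<open>V\<close> lies
  properly between \<open>U\<close> and \<open>W\<close>, and the Law of Proximity makes
  \<open>V\<close> proximate to \<open>U\<close> as well.\<close>

lemma prox_targets_succ:
  assumes "W \<in> succs V"
  obtains "prox_targets W = {V}"
  | U where "U \<in> prox_targets V" "U \<noteq> V" "prox_targets W = {V, U}"
proof (cases "prox_targets W = {V}")
  case False
  then obtain U where U: "(W, U) \<in> prox D" "U \<noteq> V" using succ_prox[OF assms] by auto
  have "\<exists>\<^sub>\<le>\<^sub>1 U. (W, U) \<in> prox D \<and> U \<noteq> V"
    using assms minimal arc_vertices
    unfolding minimal_enriques_diagram_def law_of_proximity_def in_succs_iff by blast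
  then have "prox_targets W = {V, U}"
    using U succ_prox[OF assms] unfolding Uniq_def by auto
  moreover have "(U, V) \<in> arcs_D\<^sup>+"
    using prox_remote[OF assms U] trancl_succ[OF assms] U(2)
    by (auto simp: remote_predecessor_def proper_predecessor_def)
  then have "(V, U) \<in> prox D"
    using U(1) assms minimal
    unfolding minimal_enriques_diagram_def law_of_proximity_def proper_predecessor_def in_succs_iff
    by blast
  ultimately show ?thesis using that(2) U(2) by blast
qed

lemma satellite_succ_iff:
  assumes "W \<in> succs V"
  shows "W \<in> satellites D \<longleftrightarrow> prox_targets W \<noteq> {V}"
proof
  assume "W \<in> satellites D"
  then obtain U where "(W, U) \<in> prox D" "(U, W) \<notin> arcs_D"
    by (auto simp: satellites_def satellite_of_def remote_predecessor_def)
  then show "prox_targets W \<noteq> {V}" using assms by (auto simp: in_succs_iff)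
next
  assume "prox_targets W \<noteq> {V}"
  then obtain U where "(W, U) \<in> prox D" "U \<noteq> V" using succ_prox[OF assms] by auto
  then show "W \<in> satellites D"
    using prox_remote[OF assms] succ_vertex[OF assms]
    by (auto simp: satellites_def satellite_of_def)
qed

lemma satellite_targets:
  assumes "W \<in> succs V" "W \<in> satellites D"
  obtains U where "U \<in> prox_targets V" "U \<noteq> V" "prox_targets W = {V, U}"
  using assms prox_targets_succ satellite_succ_iff by metis

lemma root_not_satellite: "R \<notin> satellites D"
  using prox_targets_root by (auto simp: satellites_def satellite_of_def)

lemma vertex_cases:
  assumes "V \<in> vertices D"
  obtains "V = R" | U where "V \<in> succs U"
proof (cases "V = R")
  case False
  then have "V \<notin> roots D" by (simp add: roots_eq)
  then obtain U where "(U, V) \<in> arcs_D" using assms by (auto simp: initial_vertices_def)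
  then show ?thesis using that by (simp add: in_succs_iff)
qed (rule that)

section \<open>Exhausting the Proximity Inequality\<close>

lemma finite_prox_sources: "finite (prox_sources V)"
  by (rule finite_subset[OF _ finite_vertices]) (use prox_subset in auto)

lemma sum_sources_le:
  assumes "V \<in> vertices D" "A \<subseteq> prox_sources V"
  shows "(\<Sum>W\<in>A. weight D W) \<le> weight D V"
proof -
  have "(\<Sum>W\<in>A. weight D W) \<le> (\<Sum>W\<in>prox_sources V. weight D W)"
    using assms(2) finite_prox_sources by (intro sum_mono2) auto
  also have "\<dots> \<le> weight D V"
    using assms(1) minimal by (auto simp: minimal_enriques_diagram_def proximity_inequality_def)
  finally show ?thesis .
qed

text \<open>All weights are positive, so once \<open>A\<close> uses up the weight of
  \<open>V\<close>, no further vertex can be proximate to \<open>V\<close>.\<close>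

lemma sources_eqI:
  assumes "V \<in> vertices D" "A \<subseteq> prox_sources V" "weight D V \<le> (\<Sum>W\<in>A. weight D W)"
  shows "prox_sources V = A"
proof (rule ccontr)
  assume "prox_sources V \<noteq> A"
  then obtain W where W: "W \<in> prox_sources V" "W \<notin> A" using assms(2) by auto
  have "finite A" using assms(2) finite_prox_sources finite_subset by blast
  then have "weight D W + (\<Sum>W\<in>A. weight D W) \<le> weight D V"
    using sum_sources_le[OF assms(1), of "insert W A"] W assms(2) by simp
  moreover have "weight D W \<ge> 1" using W prox_subset weight_pos by auto
  ultimately show False using assms(3) by simp
qed

lemma succs_subset_sources: "succs V \<subseteq> prox_sources V"
  using succ_prox by auto

lemma weight_succ_le:
  assumes "W \<in> succs V"
  shows "weight D W \<le> weight D V"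
  using sum_sources_le[of V "{W}"] assms succ_prox[OF assms] arc_vertices in_succs_iff by auto

section \<open>Vertices of weight 1\<close>

lemma succs_of_weight_1:
  assumes "weight D V = 1" "W \<in> succs V"
  shows "weight D W = 1" "prox_sources V = {W}" "succs V = {W}"
proof -
  have V: "V \<in> vertices D" and W: "W \<in> vertices D" using assms arc_vertices in_succs_iff by auto
  show "weight D W = 1" using weight_succ_le[OF assms(2)] weight_pos[OF W] assms(1) by simp
  then show "prox_sources V = {W}"
    using assms succ_prox by (intro sources_eqI[OF V]) auto
  then show "succs V = {W}" using succs_subset_sources assms(2) by auto
qed

lemma free_weight_1:
  assumes "V \<in> vertices D" "weight D V = 1" "V \<notin> satellites D"
  obtains U W where "V \<in> succs U" "prox_targets V = {U}" "succs V = {W}" "weight D W = 1"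
    "prox_targets W = {V, U}"
proof -
  have "V \<in> vertices D \<Longrightarrow> weight D V = 1 \<Longrightarrow> V \<notin> satellites D \<Longrightarrow>
      \<exists>U W. V \<in> succs U \<and> prox_targets V = {U} \<and> succs V = {W} \<and> weight D W = 1 \<and>
        prox_targets W = {V, U}" for V
  proof (induction V rule: wf_induct_rule[OF wf_succs])
    case (1 V)
    have "V \<notin> leaves D"
      using 1(3,4) minimal unfolding minimal_enriques_diagram_def law_of_minimality_def by blast
    then obtain W where W: "W \<in> succs V" using 1(2) by (auto simp: leaves_def)
    note W1 = succs_of_weight_1[OF 1(3) W]
    have "W \<in> satellites D"
    \<comment> \<open>If \<open>W\<close> were free, the induction hypothesis would give a vertex
      \<open>X\<close> after \<open>W\<close> proximate to \<open>V\<close>, whose weight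
      \<open>W\<close> already uses up.\<close>
    proof (rule ccontr)
      assume "W \<notin> satellites D"
      then obtain U X where "W \<in> succs U" "succs W = {X}" "prox_targets X = {W, U}"
        using 1(1)[of W] W W1(1) succ_vertex by blast
      then have "X \<in> prox_sources V" "X \<in> succs W" using W pred_unique by auto
      then show False using W1(2) level_succ[of X W] by auto
    qed
    then obtain U where U: "U \<in> prox_targets V" "U \<noteq> V" "prox_targets W = {V, U}"
      using satellite_targets[OF W] by metis
    \<comment> \<open>\<open>V\<close> has a target and therefore is not the root. This conclusion
      is what later excludes a root of weight 1.\<close>
    then obtain U' where U': "V \<in> succs U'"
      using vertex_cases[OF 1(2)] prox_targets_root by (metis empty_iff)
    then have "prox_targets V = {U'}" using 1(4) satellite_succ_iff by blast
    then show ?case using U U' W1 by auto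
  qed
  then show ?thesis using assms that by metis
qed

text \<open>The contradiction from the induction in \<open>free_weight_1\<close> again, now for
  \<open>V\<close> free or not: a free \<open>W\<close> would bring a second vertex proximate to
  \<open>V\<close>.\<close>

lemma weight_1_succ_satellite:
  assumes "weight D V = 1" "W \<in> succs V"
  obtains U where "U \<in> prox_targets V" "U \<noteq> V" "prox_targets W = {V, U}"
proof -
  note W = succs_of_weight_1[OF assms]
  have "W \<in> satellites D"
  proof (rule ccontr)
    assume "W \<notin> satellites D"
    then obtain U X where "W \<in> succs U" "succs W = {X}" "prox_targets X = {W, U}"
      using free_weight_1[OF succ_vertex[OF assms(2)] W(1)] by metis
    then have "X \<in> prox_sources V" "X \<in> succs W" using assms(2) pred_unique by auto
    then show False using W(2) level_succ[of X W] by auto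
  qed
  then show ?thesis using that satellite_targets[OF assms(2)] by metis
qed


section \<open>Recognising a succession\<close>

text \<open>The initial segment of length 1 is the immediate predecessor, or empty at the root;
  index \<open>d - 1\<close> counts \<open>d\<close> steps back, since position 0 is one step
  back.\<close>

fun expected_targets :: "'a list \<Rightarrow> chain_vertex \<Rightarrow> 'a set" where
  "expected_targets us (Plain m) = set (take 1 us)"
| "expected_targets us (Back m d) = insert (us ! (d - 1)) (set (take 1 us))"

text \<open>The list \<open>us\<close> holds the vertices passed on the way to \<open>w\<close>, the most recent one first.\<close>

fun realizes :: "'a list \<Rightarrow> 'a list \<Rightarrow> chain_vertex list \<Rightarrow> bool" where
  "realizes us [] [] \<longleftrightarrow> True"
| "realizes us (w # ws) (x # xs) \<longleftrightarrow> weight D w = cv_weight x \<and>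
     prox_targets w = expected_targets us x \<and> succs w = set (take 1 ws) \<and> realizes (w # us) ws xs"
| "realizes us [] (x # xs) \<longleftrightarrow> False"
| "realizes us (w # ws) [] \<longleftrightarrow> False"

lemma realizes_length: "realizes us ws xs \<Longrightarrow> length ws = length xs"
  by (induction us ws xs rule: realizes.induct) auto

lemma realizes_nth:
  assumes "realizes us ws xs" "i < length ws"
  shows "weight D (ws ! i) = cv_weight (xs ! i) \<and>
    prox_targets (ws ! i) = expected_targets (rev (take i ws) @ us) (xs ! i) \<and>
    succs (ws ! i) = (if Suc i < length ws then {ws ! Suc i} else {})"
  using assms
proof (induction us ws xs arbitrary: i rule: realizes.induct)
  case (2 us w ws x xs)
  show ?case
  proof (cases i)
    case 0
    then show ?thesis using 2 by (cases ws) auto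
  next
    case (Suc j)
    then show ?thesis using 2 by simp
  qed
qed auto

text \<open>Indexing the list of vertices is the isomorphism. It is onto because the list contains
  the root and all successors of its entries; arcs and proximities are read off from the successor
  and target sets.\<close>

lemma diagram_iso_succession:
  assumes "realizes [] (R # vs) xs" "well_placed xs"
  shows "diagram_iso (succession xs) D"
proof -
  define ws where "ws = R # vs"
  define n where "n = length ws"
  have len: "length xs = n" using realizes_length[OF assms(1)] by (simp add: n_def ws_def)
  note nth = realizes_nth[OF assms(1)[folded ws_def], folded n_def]
  have succs: "succs (ws ! i) = (if Suc i < n then {ws ! Suc i} else {})"
    and wt: "weight D (ws ! i) = cv_weight (xs ! i)" if "i < n" for i
    using nth[OF that] by auto
  \<comment> \<open>The depth recovers the position in the list, so its entries are
    distinct.\<close>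
  have level: "i < n \<Longrightarrow> level (ws ! i) = level R + i" for i
  proof (induction i)
    case (Suc i)
    then show ?case using succs[of i] level_succ[of "ws ! Suc i" "ws ! i"] by simp
  qed (simp add: ws_def)
  have eq_iff: "ws ! i = ws ! j \<longleftrightarrow> i = j" if "i < n" "j < n" for i j
    using level[OF that(1)] level[OF that(2)] by (metis add_left_cancel)
  have targets: "(ws ! i, y) \<in> prox D \<longleftrightarrow> (\<exists>j. proximate_at xs i j \<and> y = ws ! j)" if i: "i < n" for i y
  proof -
    have placed: "is_Plain (xs ! i) \<or> 2 \<le> back_steps (xs ! i) \<and> back_steps (xs ! i) \<le> i"
      using assms(2) i len by (simp add: well_placed_iff)
    have last: "set (take 1 (rev (take i ws))) = (if i = 0 then {} else {ws ! (i - 1)})"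
      using i by (cases i) (auto simp: n_def take_Suc_conv_app_nth)
    have back_nth: "rev (take i ws) ! (d - 1) = ws ! (i - d)" if "1 \<le> d" "d \<le> i" for d
      using that i by (simp add: n_def rev_nth)
    show ?thesis
    proof (cases "xs ! i")
      case (Plain m)
      then have "prox_targets (ws ! i) = (if i = 0 then {} else {ws ! (i - 1)})"
        using nth[OF i] last by simp
      then have "(ws ! i, y) \<in> prox D \<longleftrightarrow> i \<noteq> 0 \<and> y = ws ! (i - 1)" by (auto split: if_splits)
      then show ?thesis using Plain by (cases i) (auto simp: proximate_at_def)
    next
      case (Back m d)
      then have d: "2 \<le> d" "d \<le> i" using placed by auto
      then have "prox_targets (ws ! i) = {ws ! (i - d), ws ! (i - 1)}"
        using nth[OF i] last back_nth[of d] Back by simp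
      then have "(ws ! i, y) \<in> prox D \<longleftrightarrow> y = ws ! (i - d) \<or> y = ws ! (i - 1)" by auto
      moreover have "proximate_at xs i j \<longleftrightarrow> j = i - d \<or> j = i - 1" for j
        using Back d by (auto simp: proximate_at_def)
      ultimately show ?thesis by auto
    qed
  qed
  have verts: "vertices D = (!) ws ` {..<n}"
  proof (rule vertices_eqI)
    show "R \<in> (!) ws ` {..<n}" by (rule image_eqI[of _ _ 0]) (simp_all add: ws_def n_def)
    show "succs V \<subseteq> (!) ws ` {..<n}" if "V \<in> (!) ws ` {..<n}" for V
      using that succs by (auto split: if_splits)
    show "(!) ws ` {..<n} \<subseteq> vertices D"
    proof
      fix V assume "V \<in> (!) ws ` {..<n}"
      then obtain i where i: "i < n" "V = ws ! i" by auto
      then show "V \<in> vertices D"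
      proof (cases i)
        case (Suc j)
        then show ?thesis using i succs[of j] succ_vertex[of V "ws ! j"] by simp
      qed (simp add: ws_def root_vertex)
    qed
  qed
  have "arcs_D = map_prod ((!) ws) ((!) ws) ` parcs (graph (succession xs))"
  proof (intro equalityI subrelI)
    fix x y assume xy: "(x, y) \<in> arcs_D"
    then obtain i where i: "i < n" "x = ws ! i" using arc_vertices verts by blast
    then have "y \<in> succs (ws ! i)" using xy by (simp add: in_succs_iff)
    then have "Suc i < n" "y = ws ! Suc i" using succs[OF i(1)] by (auto split: if_splits)
    then show "(x, y) \<in> map_prod ((!) ws) ((!) ws) ` parcs (graph (succession xs))"
      using i by (intro image_eqI[of _ _ "(i, Suc i)"]) (auto simp: arcs_succession len)
  next
    fix x y assume "(x, y) \<in> map_prod ((!) ws) ((!) ws) ` parcs (graph (succession xs))"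
    then obtain i where "Suc i < n" "x = ws ! i" "y = ws ! Suc i" by (auto simp: arcs_succession len)
    then show "(x, y) \<in> arcs_D" using succs[of i] by (simp add: in_succs_iff[symmetric])
  qed
  moreover have "prox D = map_prod ((!) ws) ((!) ws) ` prox (succession xs)"
  proof (intro equalityI subrelI)
    fix x y assume xy: "(x, y) \<in> prox D"
    then obtain i where i: "i < n" "x = ws ! i" using prox_subset verts by blast
    then obtain j where "proximate_at xs i j" "y = ws ! j" using xy targets by auto
    then show "(x, y) \<in> map_prod ((!) ws) ((!) ws) ` prox (succession xs)"
      using i by (intro image_eqI[of _ _ "(i, j)"]) (auto simp: prox_succession[OF assms(2)] len)
  next
    fix x y assume "(x, y) \<in> map_prod ((!) ws) ((!) ws) ` prox (succession xs)"
    then obtain i j where "i < n" "proximate_at xs i j" "x = ws ! i" "y = ws ! j"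
      by (auto simp: prox_succession[OF assms(2)] len)
    then show "(x, y) \<in> prox D" using targets[of i] by auto
  qed
  moreover have "inj_on ((!) ws) {..<n}" using eq_iff by (auto simp: inj_on_def)
  ultimately show ?thesis
    unfolding diagram_iso_def using verts wt by (intro exI[of _ "(!) ws"]) (simp add: len)
qed

section \<open>Roots of weight two and three\<close>

lemma not_succ: "level W \<le> level V \<Longrightarrow> W \<notin> succs V"
  by (auto dest: level_succ)

lemma free_succ_weight_1:
  assumes "W \<in> succs V" "prox_targets W = {V}" "weight D W = 1"
  obtains X where "succs W = {X}" "weight D X = 1" "prox_targets X = {W, V}" "X \<in> prox_sources V"
    "prox_sources W = {X}"
proof -
  have "W \<notin> satellites D" using assms satellite_succ_iff by simp
  then obtain U X where X: "W \<in> succs U" "succs W = {X}" "weight D X = 1" "prox_targets X = {W, U}"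
    using free_weight_1[OF succ_vertex[OF assms(1)] assms(3)] by metis
  moreover have "U = V" using X(1) assms(1) pred_unique by simp
  ultimately show ?thesis
    using that succs_of_weight_1(2)[OF assms(3), of X] by auto
qed

text \<open>A successor of a vertex of weight 1 is a satellite, so it needs a further vertex whose proximity
  inequality is not yet exhausted.\<close>

lemma weight_1_leaf:
  assumes "weight D V = 1" "\<And>U. U \<in> prox_targets V \<Longrightarrow> prox_sources U \<inter> succs V = {}"
  shows "succs V = {}"
proof (rule ccontr)
  assume "succs V \<noteq> {}"
  then obtain W where W: "W \<in> succs V" by auto
  then obtain U where "U \<in> prox_targets V" "prox_targets W = {V, U}"
    using weight_1_succ_satellite[OF assms(1)] by metis
  then show False using assms(2) W by blast
qed

text \<open>The chain from \<open>V\<close> on does not depend on what comes before, so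
  \<open>k\<close> and \<open>ws\<close> are fixed ahead of \<open>us\<close>; this lets the result
  for a successor be extended by \<open>V\<close> in front. The hypothesis that all successors of
  \<open>V\<close> are free holds at the root and is inherited along vertices of weight 2.\<close>

lemma realizes_A_chain:
  assumes "V \<in> vertices D" "weight D V = 2" "\<And>W. W \<in> succs V \<Longrightarrow> prox_targets W = {V}"
  shows "\<exists>k\<ge>1. \<exists>ws. \<forall>us. prox_targets V = set (take 1 us) \<longrightarrow> realizes us (V # ws) (A_chain k)"
  using assms
proof (induction V rule: wf_induct_rule[OF wf_succs])
  case (1 V)
  show ?case
  proof (cases "succs V = {}")
    case True
    then have "realizes us [V] (A_chain 1)" if "prox_targets V = set (take 1 us)" for us
      using 1(3) that by (simp add: A_chain_1 del: One_nat_def)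
    then show ?thesis by (metis le_refl)
  next
    case False
    then obtain W where W: "W \<in> succs V" by auto
    have tW: "prox_targets W = {V}" using 1(4) W by simp
    have WV: "W \<in> vertices D" using W succ_vertex by simp
    have lW: "level W = Suc (level V)" using W level_succ by simp
    have "weight D W \<le> 2" "weight D W \<ge> 1" using weight_succ_le[OF W] 1(3) weight_pos[OF WV] by auto
    then consider "weight D W = 2" | "weight D W = 1" by linarith
    then show ?thesis
    proof cases
      case 1
      have "prox_sources V = {W}"
        using "1.prems" 1 tW by (intro sources_eqI) auto
      then have sV: "succs V = {W}" using succs_subset_sources W by blast
      \<comment> \<open>\<open>W\<close> alone exhausts \<open>V\<close>, so \<open>X\<close> cannot
        inherit the target \<open>V\<close> from \<open>W\<close>. Thus the hypothesis of the
        induction holds at \<open>W\<close>.\<close>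
      have "prox_targets X = {W}" if X: "X \<in> succs W" for X
      proof (rule prox_targets_succ[OF X])
        fix U assume "U \<in> prox_targets W" "prox_targets X = {W, U}"
        then have "X \<in> prox_sources V" using tW by auto
        then have "X = W" using \<open>prox_sources V = {W}\<close> by simp
        then show ?thesis using level_succ[OF X] by simp
      qed
      then obtain k ws where k: "k \<ge> 1"
        "\<And>us. prox_targets W = set (take 1 us) \<Longrightarrow> realizes us (W # ws) (A_chain k)"
        using "1.IH"[of W] W WV 1 by auto
      then have "realizes us (V # W # ws) (A_chain (Suc (Suc k)))"
        if "prox_targets V = set (take 1 us)" for us
        using that sV "1.prems" tW k(2)[of "V # us"] by (simp add: A_chain_step)
      then show ?thesis by (metis Suc_le_mono le_SucI One_nat_def zero_le)
    next
      case 2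
      obtain X where X: "succs W = {X}" "weight D X = 1" "prox_targets X = {W, V}"
          "X \<in> prox_sources V" "prox_sources W = {X}"
        using free_succ_weight_1[OF W tW 2] .
      have lX: "level X = Suc (level W)" using X level_succ by simp
      then have "W \<noteq> X" by auto
      \<comment> \<open>The weights 1 + 1 exhaust \<open>V\<close>, and \<open>X\<close> exhausts
        \<open>W\<close>. A successor of \<open>X\<close> would need one of these two as second
        target, so the chain stops here.\<close>
      then have srcV: "prox_sources V = {W, X}"
        using "1.prems" 2 X tW by (intro sources_eqI) auto
      have "X \<notin> succs V" using level_succ[of X V] lX lW by auto
      then have sV: "succs V = {W}" using srcV succs_subset_sources W by blast
      have "succs X = {}"
      proof (rule weight_1_leaf[OF X(2)])
        fix U assume "U \<in> prox_targets X"
        moreover have "W \<notin> succs X" "X \<notin> succs X" using lX not_succ by simp_all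
        ultimately show "prox_sources U \<inter> succs X = {}" using X srcV by auto
      qed
      then have "realizes us [V, W, X] (A_chain 2)" if "prox_targets V = set (take 1 us)" for us
        using that sV tW X 2 "1.prems" by (simp add: A_chain_2 insert_commute)
      then show ?thesis by (metis one_le_numeral)
    qed
  qed
qed


text \<open>The form is that of \<open>realizes_A_chain\<close>. The weight of the only successor
  \<open>W\<close> decides the family: 3 prolongs a smaller chain; 2 gives D if the successors of
  \<open>W\<close> are free, otherwise E_7 or E_8; 1 gives D_5 or E_6. Larger l arise only by
  prepending.\<close>

lemma realizes_triple_chain:
  assumes "V \<in> vertices D" "weight D V = 3" "\<And>W. W \<in> succs V \<Longrightarrow> prox_targets W = {V}"
  shows "\<exists>xs\<in>triple_chains. \<exists>ws. \<forall>us. prox_targets V = set (take 1 us) \<longrightarrow> realizes us (V # ws) xs"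
  using assms
proof (induction V rule: wf_induct_rule[OF wf_succs])
  case (1 V)
  note V = 1(2-3)
  show ?case
  proof (cases "succs V = {}")
    case True
    then have "realizes us [V] (D_chain 4)" if "prox_targets V = set (take 1 us)" for us
      using 1(3) that by (simp add: D_chain_4)
    then show ?thesis using triple_chains_intros(1)[of 4] by blast
  next
    case False
    then obtain W where W: "W \<in> succs V" by auto
    have tW: "prox_targets W = {V}" using 1(4) W by simp
    have WV: "W \<in> vertices D" using W succ_vertex by simp
    have lW: "level W = Suc (level V)" using W level_succ by simp
    have wW: "weight D W \<le> 3" "weight D W \<ge> 1"
      using weight_succ_le[OF W] 1(3) weight_pos[OF WV] by auto
    show ?thesis
    proof (cases "weight D W = 3")
      case W3: True
      have srcV: "prox_sources V = {W}"
        using V W3 tW by (intro sources_eqI) auto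
      then have sV: "succs V = {W}" using succs_subset_sources W by blast
      have "prox_targets X = {W}" if X: "X \<in> succs W" for X
      proof (rule prox_targets_succ[OF X])
        fix U assume "U \<in> prox_targets W" "prox_targets X = {W, U}"
        then have "X \<in> prox_sources V" using tW by auto
        then have "X = W" using srcV by simp
        then show ?thesis using level_succ[OF X] by simp
      qed
      then obtain xs ws where xs: "xs \<in> triple_chains"
        "\<And>us. prox_targets W = set (take 1 us) \<Longrightarrow> realizes us (W # ws) xs"
        using "1.IH"[of W] W WV W3 by auto
      have "realizes us (V # W # ws) (Plain 3 # xs)" if "prox_targets V = set (take 1 us)" for us
        using that sV V tW xs(2)[of "V # us"] by simp
      then show ?thesis using Plain_3_Cons_triple_chains[OF xs(1)] by blast
    next
      case W_less: False
      \<comment> \<open>\<open>A\<close> brings a satellite \<open>X\<close> that is also proximate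
        to \<open>V\<close>, leaving at most 1 for \<open>B\<close>. Then \<open>B\<close> has
        weight 1 and brings a satellite of its own, and the four weights exceed 3.\<close>
      have False if AB: "A \<in> succs V" "B \<in> succs V" "A \<noteq> B" "weight D A = 1" for A B
      proof -
        have free: "\<exists>X. X \<in> succs Y \<and> X \<in> prox_sources V \<and> weight D X = 1"
          if "Y \<in> succs V" "weight D Y = 1" for Y
          using free_succ_weight_1[OF that(1) 1(4)[OF that(1)] that(2)] by (metis insertI1)
        have src: "A \<in> prox_sources V" "B \<in> prox_sources V"
          using AB succs_subset_sources by blast+
        have lv: "level A = Suc (level V)" "level B = Suc (level V)" using AB level_succ by simp_all
        obtain X where X: "X \<in> succs A" "X \<in> prox_sources V" "weight D X = 1"
          using free AB by blast
        then have "level X = Suc (level A)" using level_succ by simp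
        then have ne: "X \<noteq> A" "X \<noteq> B" using lv by auto
        then have "weight D A + weight D B + weight D X \<le> 3"
          using sum_sources_le[OF V(1), of "{A, B, X}"] V(2) AB src X by simp
        moreover have "weight D B \<ge> 1" using AB succ_vertex weight_pos by blast
        ultimately have B: "weight D B = 1" using AB X by simp
        then obtain Y where Y: "Y \<in> succs B" "Y \<in> prox_sources V" "weight D Y = 1"
          using free AB by blast
        then have "level Y = Suc (level B)" using level_succ by simp
        then have "Y \<noteq> A" "Y \<noteq> B" using lv by auto
        moreover have "X \<noteq> Y" using X Y AB pred_unique by blast
        ultimately have "weight D A + weight D B + weight D X + weight D Y \<le> 3"
          using sum_sources_le[OF V(1), of "{A, B, X, Y}"] V(2) AB src X Y ne by simp
        then show False using AB B X Y by simp
      qed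
      \<comment> \<open>Two successors share a total weight of at most 3, so the preceding fact
        applies to any such pair.\<close>
      moreover have "weight D W = 1 \<or> weight D W' = 1" if "W' \<in> succs V" "W' \<noteq> W" for W'
      proof -
        have "weight D W + weight D W' \<le> 3"
          using sum_sources_le[OF V(1), of "{W, W'}"] V(2) W that succs_subset_sources[of V] by auto
        moreover have "weight D W' \<ge> 1" using that succ_vertex weight_pos by blast
        ultimately show ?thesis using wW by linarith
      qed
      ultimately have sV: "succs V = {W}" using W by blast
      consider "weight D W = 2" "\<And>X. X \<in> succs W \<Longrightarrow> prox_targets X = {W}"
        | X where "weight D W = 2" "X \<in> succs W" "prox_targets X \<noteq> {W}"
        | "weight D W = 1"
        using wW W_less by force
      then show ?thesis
      proof cases
        case 1
        obtain k ws where k: "k \<ge> 1"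
          "\<And>us. prox_targets W = set (take 1 us) \<Longrightarrow> realizes us (W # ws) (A_chain k)"
          using realizes_A_chain[OF WV 1] by blast
        have "realizes us (V # W # ws) (D_chain (k + 5))" if "prox_targets V = set (take 1 us)" for us
          using that sV V tW k(2)[of "V # us"] by (simp only: D_chain_step[OF k(1)]) simp
        then show ?thesis using triple_chains_intros(1)[of "k + 5"] by auto
      next
        case (2 X)
        obtain U where "U \<in> prox_targets W" "prox_targets X = {W, U}"
          using prox_targets_succ[OF 2(2)] 2(3) by metis
        then have tX: "prox_targets X = {W, V}" using tW by simp
        have lX: "level X = Suc (level W)" using 2 level_succ by simp
        then have WX: "W \<noteq> X" by auto
        have "X \<in> vertices D" using 2 succ_vertex by simp
        then have "weight D X \<ge> 1" using weight_pos by simp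
        moreover have "weight D W + weight D X \<le> weight D V"
          using sum_sources_le[OF V(1), of "{W, X}"] tW tX WX by auto
        \<comment> \<open>Of the weight 3 of \<open>V\<close>, the vertex \<open>W\<close> takes 2,
          so \<open>W\<close> and the satellite \<open>X\<close> exhaust \<open>V\<close>.\<close>
        ultimately have X1: "weight D X = 1" using V 2(1) by simp
        have srcV: "prox_sources V = {W, X}"
          using V 2(1) X1 tW tX WX by (intro sources_eqI) auto
        \<comment> \<open>A second successor \<open>X'\<close> of \<open>W\<close> cannot be
          proximate to the exhausted \<open>V\<close>, so it is free; it has weight 1 and brings a
          satellite \<open>Y\<close>. Then \<open>X\<close>, \<open>X'\<close> and \<open>Y\<close>
          exceed the weight 2 of \<open>W\<close>.\<close>
        have sW: "succs W = {X}"
        proof (rule ccontr)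
          assume "succs W \<noteq> {X}"
          then obtain X' where X': "X' \<in> succs W" "X' \<noteq> X" using 2(2) by blast
          then have lX': "level X' = Suc (level W)" using level_succ by simp
          have tX': "prox_targets X' = {W}"
          proof (rule prox_targets_succ[OF X'(1)])
            fix U assume "U \<in> prox_targets W" "prox_targets X' = {W, U}"
            then have "X' \<in> prox_sources V" using tW by auto
            then have "X' = W" using srcV X' by blast
            then show ?thesis using lX' by simp
          qed
          have "weight D X + weight D X' \<le> weight D W"
            using sum_sources_le[OF WV, of "{X, X'}"] tX tX' X'(2) by auto
          moreover have "weight D X' \<ge> 1" using X' succ_vertex weight_pos by blast
          ultimately have X'1: "weight D X' = 1" using 2(1) X1 by simp
          obtain Y where Y: "succs X' = {Y}" "weight D Y = 1" "Y \<in> prox_sources W"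
            using free_succ_weight_1[OF X'(1) tX' X'1] by metis
          then have "level Y = Suc (level X')" using level_succ by simp
          then have "Y \<noteq> X" "Y \<noteq> X'" using lX lX' by auto
          then have "weight D X + weight D X' + weight D Y \<le> weight D W"
            using sum_sources_le[OF WV, of "{X, X', Y}"] tX tX' X'(2) Y by auto
          then show False using X1 X'1 Y 2(1) by simp
        qed
        show ?thesis
        proof (cases "succs X = {}")
          case True
          then have "realizes us [V, W, X] (E_chain 1 1)"
            if "prox_targets V = set (take 1 us)" for us
            using that sV sW V tW tX X1 2(1) by (simp add: E_chain_def insert_commute)
          then show ?thesis using triple_chains_intros(2)[of 1 1] by auto
        next
          case False
          then obtain Y where Y: "Y \<in> succs X" by auto
          note Y1 = succs_of_weight_1[OF X1 Y]
          have lY: "level Y = Suc (level X)" using Y level_succ by simp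
          obtain U where U: "U \<in> prox_targets X" "prox_targets Y = {X, U}"
            using weight_1_succ_satellite[OF X1 Y] by metis
          have "Y \<noteq> W" "Y \<noteq> X" using lY lX by auto
          \<comment> \<open>\<open>X\<close> offers the targets \<open>W\<close> and
            \<open>V\<close>; since \<open>V\<close> is exhausted, \<open>Y\<close> is proximate to
            \<open>W\<close>. This is the pattern of E_8.\<close>
          then have "Y \<notin> prox_sources V" using srcV by simp
          then have tY: "prox_targets Y = {X, W}" using U tX by auto
          have srcW: "prox_sources W = {X, Y}"
            using 2(1) WV X1 Y1 tX tY \<open>Y \<noteq> X\<close> by (intro sources_eqI) auto
          have "succs Y = {}"
          proof (rule weight_1_leaf[OF Y1(1)])
            fix U assume "U \<in> prox_targets Y"
            moreover have "X \<notin> succs Y" "Y \<notin> succs Y" using lY not_succ by simp_all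
            ultimately show "prox_sources U \<inter> succs Y = {}" using tY srcW Y1(2) by auto
          qed
          then have "realizes us [V, W, X, Y] (E_chain 1 2)"
            if "prox_targets V = set (take 1 us)" for us
            using that sV sW V tW tX X1 2(1) Y1 tY by (simp add: E_chain_def insert_commute)
          then show ?thesis using triple_chains_intros(2)[of 1 2] by auto
        qed
      next
        case 3
        obtain X where X: "succs W = {X}" "weight D X = 1" "prox_targets X = {W, V}"
            "X \<in> prox_sources V" "prox_sources W = {X}"
          using free_succ_weight_1[OF W tW 3] .
        have lX: "level X = Suc (level W)" using X level_succ by simp
        show ?thesis
        proof (cases "succs X = {}")
          case True
          then have "realizes us [V, W, X] (D_chain 5)"
            if "prox_targets V = set (take 1 us)" for us
            using that sV X V tW 3 by (simp add: D_chain_5 insert_commute)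
          then show ?thesis using triple_chains_intros(1)[of 5] by auto
        next
          case False
          then obtain Y where Y: "Y \<in> succs X" by auto
          note Y1 = succs_of_weight_1[OF X(2) Y]
          have lY: "level Y = Suc (level X)" using Y level_succ by simp
          obtain U where U: "U \<in> prox_targets X" "prox_targets Y = {X, U}"
            using weight_1_succ_satellite[OF X(2) Y] by metis
          \<comment> \<open>Here \<open>X\<close> alone exhausts \<open>W\<close>, so the second
            target of \<open>Y\<close> is \<open>V\<close>, three steps back. This is the pattern of
            E_6.\<close>
          have "Y \<notin> prox_sources W" using X(5) lY by auto
          then have tY: "prox_targets Y = {X, V}" using U X(3) by auto
          have ne: "W \<noteq> X" "W \<noteq> Y" "X \<noteq> Y" using lX lY by auto
          then have srcV: "prox_sources V = {W, X, Y}"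
            using V 3 X tW tY Y1(1) by (intro sources_eqI) auto
          have "succs Y = {}"
          proof (rule weight_1_leaf[OF Y1(1)])
            fix U assume "U \<in> prox_targets Y"
            moreover have "W \<notin> succs Y" "X \<notin> succs Y" "Y \<notin> succs Y"
              using lX lY not_succ by simp_all
            ultimately show "prox_sources U \<inter> succs Y = {}" using tY srcV Y1(2) by auto
          qed
          then have "realizes us [V, W, X, Y] (E_chain 1 0)"
            if "prox_targets V = set (take 1 us)" for us
            using that sV X V tW 3 Y1 tY by (simp add: E_chain_def insert_commute numeral_3_eq_3)
          then show ?thesis using triple_chains_intros(2)[of 1 0] by auto
        qed
      qed
    qed
  qed
qed

text \<open>The root has no targets to pass on. This supplies the freeness hypothesis with which the
  walks start, with an empty history.\<close>

lemma succ_of_root_free: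
  assumes "W \<in> succs R"
  shows "prox_targets W = {R}"
  using prox_targets_succ[OF assms] prox_targets_root by (metis empty_iff)

text \<open>The root is free, and a free vertex of weight 1 has an immediate predecessor.\<close>

lemma root_weight_ge_2: "weight D R \<ge> 2"
proof (rule ccontr)
  assume "\<not> weight D R \<ge> 2"
  then have "weight D R = 1" using weight_pos[OF root_vertex] by simp
  then obtain U where "R \<in> succs U"
    using free_weight_1[OF root_vertex _ root_not_satellite] by metis
  then show False using root_no_pred by (simp add: in_succs_iff)
qed

lemma root_weight_2:
  assumes "weight D R = 2"
  shows "\<exists>k\<ge>1. diagram_iso (diagram_A k) D"
proof -
  obtain k ws where "k \<ge> 1" "realizes [] (R # ws) (A_chain k)"
    using realizes_A_chain[OF root_vertex assms succ_of_root_free] prox_targets_root by force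
  then show ?thesis
    using diagram_iso_succession A_chain_properties unfolding diagram_A_def by blast
qed

lemma root_weight_3:
  assumes "weight D R = 3"
  shows "(\<exists>k\<ge>4. diagram_iso (diagram_D k) D) \<or>
    (\<exists>l\<ge>1. \<exists>j\<in>{0, 1, 2}. diagram_iso (diagram_E l j) D) \<or>
    (\<exists>l\<ge>2. \<exists>k\<ge>0. diagram_iso (diagram_J l k) D)"
proof -
  obtain xs ws where "xs \<in> triple_chains" and xs: "realizes [] (R # ws) xs"
    using realizes_triple_chain[OF root_vertex assms succ_of_root_free] prox_targets_root by force
  then consider k where "k \<ge> 4" "xs = D_chain k"
    | l j where "l \<ge> 1" "j \<in> {0, 1, 2}" "xs = E_chain l j" | l k where "l \<ge> 2" "xs = J_chain l k"
    unfolding triple_chains_def by blast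
  then show ?thesis
  proof cases
    case (1 k)
    then have "diagram_iso (diagram_D k) D"
      using diagram_iso_succession[OF xs] D_chain_properties[of k] unfolding diagram_D_def by simp
    then show ?thesis using 1(1) by metis
  next
    case (2 l j)
    then have "diagram_iso (diagram_E l j) D"
      using diagram_iso_succession[OF xs] E_chain_properties[of l j] unfolding diagram_E_def by simp
    then show ?thesis using 2(1,2) by metis
  next
    case (3 l k)
    then have "diagram_iso (diagram_J l k) D"
      using diagram_iso_succession[OF xs] J_chain_properties[of l k] unfolding diagram_J_def by simp
    then show ?thesis using 3(1) by (metis zero_le)
  qed
qed


section \<open>Roots of weight at least four\<close>

text \<open>The analogue of \<open>vertex_cod\<close> for an arbitrary diagram with one root. A free
  vertex of weight 1 costs nothing, so such vertices are counted through the satellites that they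
  force.\<close>

definition cost :: "'a \<Rightarrow> int" where
  "cost V = int ((weight D V + 1) choose 2) - (if V \<in> satellites D then 0 else 1)"

lemma cost_ge:
  assumes "k \<le> weight D V"
  shows "cost V \<ge> int ((k + 1) choose 2) - (if V \<in> satellites D then 0 else 1)"
  using choose_2_mono[OF assms] by (simp add: cost_def)

lemma cost_nonneg:
  assumes "V \<in> vertices D"
  shows "cost V \<ge> 0"
  using cost_ge[OF weight_pos[OF assms]] by (auto simp: numeral_2_eq_2 split: if_splits)

lemma cost_satellite:
  assumes "V \<in> satellites D"
  shows "cost V \<ge> 1"
proof -
  have "V \<in> vertices D" using assms by (simp add: satellites_def)
  then show ?thesis using cost_ge[OF weight_pos, of V] assms by (simp add: numeral_2_eq_2)
qed

lemma cost_weight_2: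
  assumes "weight D V \<ge> 2"
  shows "cost V \<ge> 2"
  using cost_ge[OF assms] by (auto simp: eval_nat_numeral split: if_splits)

lemma cost_weight_3:
  assumes "weight D V \<ge> 3"
  shows "cost V \<ge> 5"
  using cost_ge[OF assms] by (auto simp: eval_nat_numeral split: if_splits)

lemma cod_eq_sum_cost: "cod D = (\<Sum>V\<in>vertices D. cost V) - 1"
proof -
  have "free_vertices D = {V\<in>vertices D. V \<notin> satellites D}" by (auto simp: free_vertices_def)
  then have "int (card (free_vertices D)) = (\<Sum>V\<in>vertices D. if V \<notin> satellites D then 1 else 0)"
    using finite_vertices by (simp add: sum.inter_filter[symmetric])
  also have "\<dots> = (\<Sum>V\<in>vertices D. if V \<in> satellites D then 0 else 1)"
    by (intro sum.cong) auto
  finally show ?thesis by (simp add: cod_def roots_eq cost_def sum_subtractf)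
qed

lemma cost_root: "cost R = int ((weight D R + 1) choose 2) - 1"
  using root_not_satellite by (simp add: cost_def)

text \<open>The total cost is \<open>cod D + 1\<close>, at most 11. A root of weight 4 costs 10 - 1
  = 9, a heavier one at least 15 - 1 = 14. As costs are nonnegative, the remaining 2 bounds every
  set of other vertices.\<close>

lemma root_weight_4:
  assumes "weight D R \<ge> 4" "cod D \<le> 10"
  shows "weight D R = 4" "\<And>A. A \<subseteq> vertices D - {R} \<Longrightarrow> (\<Sum>V\<in>A. cost V) \<le> 2"
proof -
  have bound: "cost R + (\<Sum>V\<in>A. cost V) \<le> 11" if A: "A \<subseteq> vertices D - {R}" for A
  proof -
    have "finite A" using A finite_vertices finite_subset by blast
    then have "cost R + (\<Sum>V\<in>A. cost V) = (\<Sum>V\<in>insert R A. cost V)"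
      using A by (subst sum.insert) auto
    also have "\<dots> \<le> (\<Sum>V\<in>vertices D. cost V)"
      using A root_vertex cost_nonneg finite_vertices by (intro sum_mono2) auto
    finally show ?thesis using assms(2) cod_eq_sum_cost by simp
  qed
  show w: "weight D R = 4"
  proof (rule ccontr)
    assume "weight D R \<noteq> 4"
    then have "5 \<le> weight D R" using assms(1) by simp
    then have "cost R \<ge> 14"
      using choose_2_mono[of 5 "weight D R"] by (simp add: cost_root eval_nat_numeral)
    then show False using bound[of "{}"] by simp
  qed
  have "cost R = 9" by (simp add: cost_root w eval_nat_numeral)
  then show "(\<Sum>V\<in>A. cost V) \<le> 2" if "A \<subseteq> vertices D - {R}" for A
    using bound[OF that] by simp
qed

text \<open>The one branching diagram, to which \<open>diagram_iso_succession\<close> does not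
  apply, so the renaming is written out.\<close>

lemma diagram_iso_Y11:
  assumes "weight D R = 4" "succs R = {V, V'}" "V \<noteq> V'"
    and V: "weight D V = 1" "succs V = {W}" and V': "weight D V' = 1" "succs V' = {W'}"
    and W: "weight D W = 1" "prox_targets W = {V, R}" "succs W = {}"
    and W': "weight D W' = 1" "prox_targets W' = {V', R}" "succs W' = {}"
  shows "diagram_iso diagram_Y11 D"
proof -
  define f where "f = (!) [R, V, V', W, W']"
  \<comment> \<open>Both \<open>1\<close> and \<open>Suc 0\<close> occur because the simplifier
    rewrites the former into the latter.\<close>
  have f: "f 0 = R" "f 1 = V" "f (Suc 0) = V" "f 2 = V'" "f 3 = W" "f 4 = W'"
    by (simp_all add: f_def)
  have lV: "level V = Suc (level R)" "level V' = Suc (level R)"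
    using assms(2) level_succ by simp_all
  moreover have "level W = Suc (level V)" "level W' = Suc (level V')"
    using V V' level_succ by simp_all
  moreover have WW': "W \<noteq> W'" using W(2) W'(2) calculation \<open>V \<noteq> V'\<close> by auto
  ultimately have ne: "R \<noteq> V" "R \<noteq> V'" "R \<noteq> W" "R \<noteq> W'" "V \<noteq> W" "V \<noteq> W'" "V' \<noteq> W" "V' \<noteq> W'"
    by auto
  have tV: "prox_targets V = {R}" "prox_targets V' = {R}"
    using succ_of_root_free assms(2) by simp_all
  have verts: "vertices D = {R, V, V', W, W'}"
    using assms root_vertex succ_vertex[of V R] succ_vertex[of V' R] succ_vertex[of W V]
      succ_vertex[of W' V']
    by (intro vertices_eqI) auto
  have "arcs_D = {(R, V), (R, V'), (V, W), (V', W')}"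
  proof (intro equalityI subrelI)
    fix x y assume xy: "(x, y) \<in> arcs_D"
    then have "x \<in> {R, V, V', W, W'}" "y \<in> succs x" using verts arc_vertices by (auto simp: in_succs_iff)
    then show "(x, y) \<in> {(R, V), (R, V'), (V, W), (V', W')}"
      using assms by auto
  next
    fix x y assume "(x, y) \<in> {(R, V), (R, V'), (V, W), (V', W')}"
    then have "y \<in> succs x" using assms by auto
    then show "(x, y) \<in> arcs_D" by (simp add: in_succs_iff)
  qed
  moreover have "prox D = {(V, R), (V', R), (W, V), (W', V'), (W, R), (W', R)}"
  proof (intro equalityI subrelI)
    fix x y assume xy: "(x, y) \<in> prox D"
    then have "x \<in> {R, V, V', W, W'}" "y \<in> prox_targets x" using verts prox_subset by auto
    then show "(x, y) \<in> {(V, R), (V', R), (W, V), (W', V'), (W, R), (W', R)}"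
      using tV W(2) W'(2) prox_targets_root by auto
  next
    fix x y assume "(x, y) \<in> {(V, R), (V', R), (W, V), (W', V'), (W, R), (W', R)}"
    then have "y \<in> prox_targets x" using tV W(2) W'(2) by auto
    then show "(x, y) \<in> prox D" by simp
  qed
  ultimately show ?thesis
    unfolding diagram_iso_def
    by (intro exI[of _ f]) (use ne WW' assms verts in \<open>simp add: f inj_on_def\<close>)
qed

text \<open>A successor of weight 2 spends all of the remaining cost 2 and stands alone, which is
  X_{1,2}. Otherwise each successor of the root forces a satellite, everything beyond is a satellite
  too, and at most two are affordable: one gives X_{1,1}, two in a row Z_{11}, two on different
  branches Y_{1,1}.\<close>

lemma root_weight_ge_4:
  assumes "weight D R \<ge> 4" "cod D \<le> 10"
  shows "\<exists>N\<in>{diagram_X1 0, diagram_X1 1, diagram_X1 2, diagram_Y11, diagram_Z11}. diagram_iso N D"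
proof -
  note wR = root_weight_4(1)[OF assms]
  note bound = root_weight_4(2)[OF assms]
  have not_R: "V \<in> vertices D - {R}" if "V \<in> succs U" for U V
    using that succ_vertex root_no_pred by (auto simp: in_succs_iff)
  have satV: "V \<in> vertices D - {R}" if "V \<in> satellites D" for V
    using that root_not_satellite by (auto simp: satellites_def)
  have satW: "V \<in> satellites D" if "V \<in> succs U" "prox_targets V = {U, X}" "X \<noteq> U" for U V X
    using that satellite_succ_iff[OF that(1)] by auto
  have isoI: "diagram_iso (succession xs) D"
    if "realizes [] (R # vs) xs" "lawful xs" for vs xs
    using that diagram_iso_succession by (simp add: lawful_def)
  have lawful: "\<forall>xs\<in>set [[Plain 4], [Plain 4, Plain 1, Back 1 2], [Plain 4, Plain 2],
      [Plain 4, Plain 1, Back 1 2, Back 1 3]]. lawful xs"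
    by code_simp
  consider "succs R = {}" | V where "V \<in> succs R" "weight D V \<noteq> 1"
    | V where "V \<in> succs R" "\<And>V. V \<in> succs R \<Longrightarrow> weight D V = 1"
    by blast
  then show ?thesis
  proof cases
    case 1
    then have "realizes [] [R] [Plain 4]" using wR prox_targets_root by simp
    from isoI[OF this] have "diagram_iso (diagram_X1 0) D" using lawful by (simp add: diagram_X1_def)
    then show ?thesis by blast
  next
    case (2 V)
    have V: "V \<in> vertices D - {R}" using not_R 2 by blast
    have "weight D V < 3"
      using cost_weight_3[of V] bound[of "{V}"] V by force
    moreover have "weight D V \<ge> 1" using V weight_pos by simp
    ultimately have w2: "weight D V = 2" using 2(2) by simp
    \<comment> \<open>No cost is left besides that of \<open>V\<close>, so another vertex would be
      free of weight 1. It would be followed by a satellite of weight 1, which is different from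
      \<open>V\<close> and has positive cost.\<close>
    have only: "U = V" if U: "U \<in> vertices D - {R}" for U
    proof (rule ccontr)
      assume "U \<noteq> V"
      have no_cost: "X = V \<or> cost X \<le> 0" if "X \<in> vertices D - {R}" for X
        using bound[of "{V, X}"] cost_weight_2[of V] w2 V that by (cases "X = V") auto
      have no_sat: "X = V" if "X \<in> satellites D" for X
        using no_cost[OF satV[OF that]] cost_satellite[OF that] by simp
      have "weight D U < 2" using no_cost[OF U] cost_weight_2[of U] \<open>U \<noteq> V\<close> by force
      then have "weight D U = 1" "U \<notin> satellites D"
        using weight_pos[of U] U no_sat \<open>U \<noteq> V\<close> by auto
      then obtain P W where "U \<in> succs P" "prox_targets U = {P}" "succs U = {W}"
        "weight D W = 1" "prox_targets W = {U, P}"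
        using free_weight_1[of U] U by blast
      moreover from this have "P \<noteq> U" using level_succ[of U P] by auto
      ultimately have "W \<in> satellites D" "W \<noteq> V" using satW[of W U P] w2 by auto
      then show False using no_sat by simp
    qed
    have sub: "succs U \<subseteq> {V}" for U using only not_R by auto
    have "V \<notin> succs V" by (simp add: not_succ)
    then have "succs R = {V}" "succs V = {}" using sub[of R] sub[of V] 2(1) by auto
    then have "realizes [] [R, V] [Plain 4, Plain 2]"
      using wR prox_targets_root succ_of_root_free[OF 2(1)] w2 by simp
    from isoI[OF this] have "diagram_iso (diagram_X1 2) D" using lawful by (simp add: diagram_X1_def)
    then show ?thesis by blast
  next
    case (3 V)
    have branch: "\<exists>W. succs U = {W} \<and> weight D W = 1 \<and> prox_targets W = {U, R} \<and>
        prox_sources U = {W} \<and> W \<in> satellites D" if U: "U \<in> succs R" for U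
    proof -
      obtain W where "succs U = {W}" "weight D W = 1" "prox_targets W = {U, R}" "prox_sources U = {W}"
        using free_succ_weight_1[OF U succ_of_root_free[OF U] 3(2)[OF U]] by metis
      moreover have "R \<noteq> U" using level_succ[OF U] by auto
      ultimately show ?thesis using satW[of W U R] by auto
    qed
    \<comment> \<open>\<open>W\<close> exhausts \<open>U\<close>, so of the targets of
      \<open>W\<close> only the root can be passed on to \<open>X\<close>.\<close>
    have deep: "X \<in> satellites D \<and> weight D X = 1 \<and> prox_targets X = {W, R} \<and> succs W = {X} \<and>
          prox_sources W = {X}"
      if U: "U \<in> succs R" and W: "succs U = {W}" "weight D W = 1" "prox_targets W = {U, R}"
        "prox_sources U = {W}" and X: "X \<in> succs W" for U W X
    proof -
      note X1 = succs_of_weight_1[OF W(2) X]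
      have lX: "level X = Suc (level W)" using X level_succ by simp
      obtain Z where Z: "Z \<in> prox_targets W" "Z \<noteq> W" "prox_targets X = {W, Z}"
        using weight_1_succ_satellite[OF W(2) X] by metis
      have "X \<notin> prox_sources U" using W(4) lX by auto
      then have "prox_targets X = {W, R}" using Z W(3) by auto
      moreover have "X \<in> satellites D" using satW[OF X Z(3,2)] .
      ultimately show ?thesis using X1 by simp
    qed
    obtain W where W: "succs V = {W}" "weight D W = 1" "prox_targets W = {V, R}"
        "prox_sources V = {W}" "W \<in> satellites D"
      using branch[OF 3(1)] by metis
    have lV: "level V = Suc (level R)" and lW: "level W = Suc (level V)"
      using level_succ[OF 3(1)] level_succ[of W V] W by simp_all
    have tV: "prox_targets V = {R}" using succ_of_root_free[OF 3(1)] .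
    have wV: "weight D V = 1" using 3 by simp
    \<comment> \<open>Three distinct satellites would cost at least 3.\<close>
    have three: False if "{A, B, C} \<subseteq> satellites D" "card {A, B, C} = 3" for A B C
    proof -
      have "(\<Sum>V\<in>{A, B, C}. 1) \<le> (\<Sum>V\<in>{A, B, C}. cost V)"
        using that(1) cost_satellite by (intro sum_mono) auto
      also have "\<dots> \<le> 2" using that(1) satV by (intro bound) auto
      finally show False using that(2) by simp
    qed
    show ?thesis
    proof (cases "succs R = {V}")
      case sR: True
      show ?thesis
      proof (cases "succs W = {}")
        case True
        then have "realizes [] [R, V, W] [Plain 4, Plain 1, Back 1 2]"
          using sR wR prox_targets_root W wV tV by (simp add: insert_commute)
        from isoI[OF this] have "diagram_iso (diagram_X1 1) D" using lawful by (simp add: diagram_X1_def)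
        then show ?thesis by blast
      next
        case False
        then obtain X where X: "X \<in> succs W" by auto
        note X' = deep[OF 3(1) W(1-4) X]
        have lX: "level X = Suc (level W)" using X level_succ by simp
        have "succs X = {}"
        proof (rule ccontr)
          assume "succs X \<noteq> {}"
          then obtain Y where Y: "Y \<in> succs X" by auto
          have lY: "level Y = Suc (level X)" using Y level_succ by simp
          obtain Z where "Z \<noteq> X" "prox_targets Y = {X, Z}"
            using weight_1_succ_satellite[OF _ Y] X' by metis
          then have "Y \<in> satellites D" using satW[OF Y] by blast
          moreover have "W \<noteq> X" "W \<noteq> Y" "X \<noteq> Y" using lX lY by auto
          ultimately show False using three[of W X Y] X' W(5) by simp
        qed
        then have "realizes [] [R, V, W, X] [Plain 4, Plain 1, Back 1 2, Back 1 3]"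
          using sR wR prox_targets_root W wV tV X' by (simp add: insert_commute numeral_3_eq_3)
        from isoI[OF this] have "diagram_iso diagram_Z11 D" using lawful by (simp add: diagram_Z11_def)
        then show ?thesis by blast
      qed
    next
      case False
      then obtain V' where V': "V' \<in> succs R" "V' \<noteq> V" using 3(1) by blast
      obtain W' where W': "succs V' = {W'}" "weight D W' = 1" "prox_targets W' = {V', R}"
          "prox_sources V' = {W'}" "W' \<in> satellites D"
        using branch[OF V'(1)] by metis
      have lV': "level V' = Suc (level R)" and lW': "level W' = Suc (level V')"
        using level_succ[OF V'(1)] level_succ[of W' V'] W' by simp_all
      have WW': "W \<noteq> W'" using W(1) W'(1) V'(2) pred_unique[of W V V'] by auto
      have leaf: "succs Y = {}" if "Y \<in> {W, W'}" for Y
      proof (rule ccontr)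
        assume "succs Y \<noteq> {}"
        then obtain X where X: "X \<in> succs Y" by auto
        then have "X \<in> satellites D"
          using that deep[OF 3(1) W(1-4)] deep[OF V'(1) W'(1-4)] by blast
        moreover have "level X = Suc (level Y)" using X level_succ by simp
        then have "X \<noteq> W" "X \<noteq> W'" using that lW lW' lV lV' by auto
        ultimately show False using three[of W W' X] W(5) W'(5) WW' by simp
      qed
      have "succs R = {V, V'}"
      proof (rule ccontr)
        assume "succs R \<noteq> {V, V'}"
        then obtain U where U: "U \<in> succs R" "U \<noteq> V" "U \<noteq> V'" using 3(1) V'(1) by blast
        then obtain Y where Y: "succs U = {Y}" "Y \<in> satellites D" using branch by metis
        then have "Y \<noteq> W" "Y \<noteq> W'" using W(1) W'(1) U pred_unique[of Y U] by blast+
        then show False using three[of W W' Y] W(5) W'(5) WW' Y by simp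
      qed
      then have "diagram_iso diagram_Y11 D"
        using diagram_iso_Y11[of V V' W W'] wR V' wV 3(2)[OF V'(1)] W W' leaf by simp
      then show ?thesis by blast
    qed
  qed
qed

end

section \<open>The classification\<close>

lemma succession_renaming:
  assumes "diagram_iso (succession xs) D"
  obtains f where "diagram_renaming (succession xs) D f"
  using diagram_isoE[OF assms arcs_succession_subset prox_succession_subset] .

lemma cod_of_succession_iso:
  assumes "diagram_iso (succession xs) D" "xs \<noteq> []" "well_placed xs"
  shows "cod D = (\<Sum>x\<leftarrow>xs. vertex_cod x) - 1"
proof -
  obtain f where "diagram_renaming (succession xs) D f" using succession_renaming[OF assms(1)] .
  then show ?thesis using cod_succession[OF assms(2,3)] diagram_renaming.cod_eq by metis
qed

lemma minimal_of_iso: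
  assumes "diagram_iso N D" "parcs (graph N) \<subseteq> vertices N \<times> vertices N"
    and "minimal_enriques_diagram N" "rooted_tree (graph N)"
  shows "minimal_enriques_diagram D \<and> (\<exists>R. roots D = {R}) \<and> cod D = cod N"
proof -
  have "prox N \<subseteq> vertices N \<times> vertices N"
    using assms(3) by (simp add: minimal_enriques_diagram_def)
  then obtain f where f: "diagram_renaming N D f" using diagram_isoE[OF assms(1,2)] by blast
  have "rooted_tree (graph D)" using diagram_renaming.rooted_tree[OF f assms(4)] .
  then show ?thesis
    using diagram_renaming.minimal_enriques_diagram[OF f assms(3,4)] diagram_renaming.cod_eq[OF f]
    by (simp add: rooted_tree_def)
qed

lemma succession_of_iso:
  assumes "diagram_iso (succession xs) D" "lawful xs" "(\<Sum>x\<leftarrow>xs. vertex_cod x) \<le> 11"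
  shows "minimal_enriques_diagram D \<and> (\<exists>R. roots D = {R}) \<and> cod D \<le> 10"
  using minimal_of_iso[OF assms(1) arcs_succession_subset
      minimal_enriques_diagram_succession[OF assms(2)] rooted_tree_succession]
    cod_succession[of xs] assms(2,3)
  by (simp add: lawful_def)

lemma Y11_of_iso:
  assumes "diagram_iso diagram_Y11 D"
  shows "minimal_enriques_diagram D \<and> (\<exists>R. roots D = {R}) \<and> cod D \<le> 10"
  using minimal_of_iso[OF assms _ minimal_enriques_diagram_Y11 rooted_tree_Y11] cod_Y11 by simp

text \<open>The codimension is linear in the indices. It first reaches 11 at A_11, at D_11, at E_12,
  where l = 2 and j = 0, and at J_{2,2}; for l at least 3, J_{l,k} has codimension at least
  14.\<close>

lemma cod_bound_named:
  assumes "diagram_iso N D" "cod D \<le> 10"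
  shows "k \<ge> 1 \<Longrightarrow> N = diagram_A k \<Longrightarrow> k \<le> 10"
    and "k \<ge> 4 \<Longrightarrow> N = diagram_D k \<Longrightarrow> k \<le> 10"
    and "l \<ge> 1 \<Longrightarrow> j \<in> {0, 1, 2} \<Longrightarrow> N = diagram_E l j \<Longrightarrow> l = 1"
    and "l \<ge> 2 \<Longrightarrow> N = diagram_J l k \<Longrightarrow> l = 2 \<and> k \<le> 1"
proof -
  note [simp] = diagram_A_def diagram_D_def diagram_E_def diagram_J_def
  show "k \<ge> 1 \<Longrightarrow> N = diagram_A k \<Longrightarrow> k \<le> 10"
    using assms cod_of_succession_iso[of "A_chain k" D] A_chain_properties[of k] by simp
  show "k \<ge> 4 \<Longrightarrow> N = diagram_D k \<Longrightarrow> k \<le> 10"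
    using assms cod_of_succession_iso[of "D_chain k" D] D_chain_properties[of k] by simp
  show "l \<ge> 1 \<Longrightarrow> j \<in> {0, 1, 2} \<Longrightarrow> N = diagram_E l j \<Longrightarrow> l = 1"
    using assms cod_of_succession_iso[of "E_chain l j" D] E_chain_properties[of l j] by simp
  show "l \<ge> 2 \<Longrightarrow> N = diagram_J l k \<Longrightarrow> l = 2 \<and> k \<le> 1"
    using assms cod_of_succession_iso[of "J_chain l k" D] J_chain_properties[of l k] by simp
qed

theorem mainTheorem3:
  fixes D :: "'a weighted_diagram"
  shows
    "(\<forall>R. minimal_enriques_diagram D \<and> roots D = {R} \<longrightarrow>
        weight D R \<ge> 2 \<and>
        (weight D R = 2 \<longrightarrow> (\<exists>k\<ge>1. diagram_iso (diagram_A k) D)) \<and>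
        (weight D R = 3 \<longrightarrow>
           (\<exists>k\<ge>4. diagram_iso (diagram_D k) D) \<or>
           (\<exists>l\<ge>1. \<exists>j\<in>{0, 1, 2}. diagram_iso (diagram_E l j) D) \<or>
           (\<exists>l\<ge>2. \<exists>k\<ge>0. diagram_iso (diagram_J l k) D)) \<and>
        (weight D R \<ge> 4 \<and> cod D \<le> 10 \<longrightarrow>
           weight D R = 4 \<and>
           (\<exists>N \<in> {diagram_X1 0, diagram_X1 1, diagram_X1 2, diagram_Y11, diagram_Z11}.
              diagram_iso N D))) \<and>
     (minimal_enriques_diagram D \<and> (\<exists>R. roots D = {R}) \<and> cod D \<le> 10 \<longleftrightarrow>
        (\<exists>N \<in> diagram_A ` {1..10} \<union> diagram_D ` {4..10} \<union>
               {diagram_J 2 0, diagram_J 2 1, diagram_E 1 0, diagram_E 1 1, diagram_E 1 2,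
                diagram_X1 0, diagram_X1 1, diagram_X1 2, diagram_Z11, diagram_Y11}.
           diagram_iso N D))"
    (is "?structure \<and> (?small \<longleftrightarrow> (\<exists>N\<in>?list. diagram_iso N D))")
proof
  show ?structure
  proof (intro allI impI)
    fix R assume "minimal_enriques_diagram D \<and> roots D = {R}"
    then interpret one_root_diagram D R by unfold_locales simp_all
    show "weight D R \<ge> 2 \<and>
        (weight D R = 2 \<longrightarrow> (\<exists>k\<ge>1. diagram_iso (diagram_A k) D)) \<and>
        (weight D R = 3 \<longrightarrow>
           (\<exists>k\<ge>4. diagram_iso (diagram_D k) D) \<or>
           (\<exists>l\<ge>1. \<exists>j\<in>{0, 1, 2}. diagram_iso (diagram_E l j) D) \<or>
           (\<exists>l\<ge>2. \<exists>k\<ge>0. diagram_iso (diagram_J l k) D)) \<and>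
        (weight D R \<ge> 4 \<and> cod D \<le> 10 \<longrightarrow>
           weight D R = 4 \<and>
           (\<exists>N \<in> {diagram_X1 0, diagram_X1 1, diagram_X1 2, diagram_Y11, diagram_Z11}.
              diagram_iso N D))"
      by (intro conjI impI root_weight_ge_2 root_weight_2 root_weight_3 root_weight_4(1)
          root_weight_ge_4) auto
  qed
  show "?small \<longleftrightarrow> (\<exists>N\<in>?list. diagram_iso N D)"
  proof
    assume small: ?small
    then obtain R where "minimal_enriques_diagram D" "roots D = {R}" by blast
    then interpret one_root_diagram D R by unfold_locales
    have cod: "cod D \<le> 10" using small by blast
    note bounds = cod_bound_named[OF _ cod]
    consider "weight D R = 2" | "weight D R = 3" | "weight D R \<ge> 4"
      using root_weight_ge_2 by linarith
    then show "\<exists>N\<in>?list. diagram_iso N D"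
    proof cases
      case 1
      obtain k where k: "k \<ge> 1" "diagram_iso (diagram_A k) D" using root_weight_2[OF 1] by blast
      then have "diagram_A k \<in> diagram_A ` {1..10}" using bounds(1)[OF k(2,1) refl] by simp
      then show ?thesis using k(2) by (intro bexI[of _ "diagram_A k"] UnI1)
    next
      case 2
      consider (D) k where "k \<ge> 4" "diagram_iso (diagram_D k) D"
        | (E) l j where "l \<ge> 1" "j \<in> {0, 1, 2}" "diagram_iso (diagram_E l j) D"
        | (J) l k where "l \<ge> 2" "diagram_iso (diagram_J l k) D"
        using root_weight_3[OF 2] by metis
      then show ?thesis
      proof cases
        case (D k)
        then have "diagram_D k \<in> diagram_D ` {4..10}" using bounds(2)[OF D(2,1) refl] by simp
        then show ?thesis using D(2) by (intro bexI[of _ "diagram_D k"] UnI1[OF UnI2])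
      next
        case (E l j)
        then have "l = 1" using bounds(3)[OF E(3,1,2) refl] by simp
        then have "diagram_E l j \<in> {diagram_E 1 0, diagram_E 1 1, diagram_E 1 2}"
          using E(2) by auto
        then show ?thesis using E(3) by blast
      next
        case (J l k)
        then have "l = 2" "k = 0 \<or> k = 1" using bounds(4)[OF J(2,1) refl] by auto
        then have "diagram_J l k \<in> {diagram_J 2 0, diagram_J 2 1}" by auto
        then show ?thesis using J(2) by blast
      qed
    next
      case 3
      then show ?thesis using root_weight_ge_4[OF 3 cod] by blast
    qed
  next
    assume "\<exists>N\<in>?list. diagram_iso N D"
    then obtain N where N: "N \<in> ?list" "diagram_iso N D" by blast
    \<comment> \<open>All listed diagrams but Y_{1,1} are successions of these lists, so one
      evaluated lemma yields minimality and the bound on \<open>cod\<close> for all of them.\<close>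
    let ?chains = "map A_chain [1..<11] @ map D_chain [4..<11] @
      [J_chain 2 0, J_chain 2 1, E_chain 1 0, E_chain 1 1, E_chain 1 2, [Plain 4],
       [Plain 4, Plain 1, Back 1 2], [Plain 4, Plain 2], [Plain 4, Plain 1, Back 1 2, Back 1 3]]"
    have "diagram_A ` {1..10} = succession ` set (map A_chain [1..<11])"
      "diagram_D ` {4..10} = succession ` set (map D_chain [4..<11])"
      unfolding set_map image_image
      by (rule image_cong; auto simp: diagram_A_def diagram_D_def)+
    moreover have "{diagram_J 2 0, diagram_J 2 1, diagram_E 1 0, diagram_E 1 1, diagram_E 1 2,
        diagram_X1 0, diagram_X1 1, diagram_X1 2, diagram_Z11} \<subseteq> succession ` set
          [J_chain 2 0, J_chain 2 1, E_chain 1 0, E_chain 1 1, E_chain 1 2, [Plain 4],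
           [Plain 4, Plain 1, Back 1 2], [Plain 4, Plain 2], [Plain 4, Plain 1, Back 1 2, Back 1 3]]"
      by (simp add: diagram_E_def diagram_J_def diagram_X1_def diagram_Z11_def)
    ultimately have "?list \<subseteq> insert diagram_Y11 (succession ` set ?chains)"
      unfolding set_append image_Un by blast
    then consider "N = diagram_Y11" | xs where "xs \<in> set ?chains" "N = succession xs"
      using N(1) by blast
    then show ?small
    proof cases
      case 1
      then show ?thesis using Y11_of_iso N(2) by simp
    next
      case (2 xs)
      then show ?thesis using succession_of_iso[of xs D] lawful_small_chains N(2) by blast
    qed
  qed
qed

end
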